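(* The computational complexity (number of arithmetic operations for node $i$ at one step, i.e. for computing $\hat x_{k+1,i}$ and $P_{k+1,i}$ from $y_{k+1,i}$ and $\hat x_{k,j},P_{k,j}$, $j\in\mathcal N_i$) of the distributed state estimation algorithm described in the context is $O(|\mathcal N_i|n^3+r^3)$, where $\mathcal N_i$ is the neighbour set of node $i$, $n$ is the state dimension and $r$ is the measurement dimension.
   Context: Setting. A network of $N$ nodes has states $x_{k,i}\in\mathbb R^n$ with $x_{k+1,i}=\hat f(x_{k,i})+\Delta f_{k,i}x_{k,i}+a\sum_{j\in\mathcal N_i}\pi_{ij}Gx_{k,j}+\omega_{k,i}$ and measurements $y_{k,i}=H_ix_{k,i}+\nu_{k,i}\in\mathbb R^r$. Here $a>0$; $\mathcal N_i$ is the neighbour set of $i$ (including $i$); $\pi_{ij}\ne0$ if $j\in\mathcal N_i$ and $\pi_{ij}=0$ otherwise; $G\in\mathbb R^{n\times n}$, $H_i\in\mathbb R^{r\times n}$; $\omega_{k,i},\nu_{k,i}$ are white Gaussian noises with covariances $Q_{k,i}>0$, $R_{k,i}>0$; $E_{k,i}=[E_{1,k,i},E_{2,k,i}]$ is a known matrix describing uncertainty and linearization error ($\Delta f_{k,i}=E_{1,k,i}\Delta_{1,k,i}$ with $\|\Delta_{1,k,i}\|_2\le 1$, and $\hat f(x_{k,i})-\hat f(\hat x_{k,i})=(F_{k,i}+E_{2,k,i}\Delta_{2,k,i})(x_{k,i}-\hat x_{k,i})$ with $\|\Delta_{2,k,i}\|_2\le1$); $F_{k,i}=\frac{\partial\hat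 f(x)}{\partial x}\big|_{\hat x_{k,i}}$. The scalars $\overline\lambda_{k,i}$ and $\alpha_{k,i}\in[0,1]$ are given parameters of the algorithm. Algorithm (node $i$, step $k+1$). Exchange $(\hat x_{k,i},P_{k,i})$ with neighbours, then compute $$P_{k+1,i}=(1+a)\big(\breve P_{k+1,i}^{-1}+H_i^T\hat R_{k+1,i}^{-1}H_i+2\overline\lambda_{k,i}I_n\big)^{-1}+(a+a^2)(N-1)\sum_{j\in\mathcal N_i,j\ne i}\pi_{ij}^2G\big(P_{k,j}^{-1}+G^TH_i^TZ_{k,ij}H_iG\big)^{-1}G^T,$$ with $\breve P_{k+1,i}=(F_{k,i}+a\pi_{ii}G)P_{k,i}(F_{k,i}+a\pi_{ii}G)^T+Q_{k,i}$, $\hat R_{k+1,i}=(1+a)^{-1}R_{k+1,i}-\overline\lambda_{k,i}^{-1}H_iE_{k,i}E_{k,i}^TH_i^T$, $Z_{k,ij}=\pi_{ij}^2(a+a^2)(N-1)R_{k+1,i}^{-1}$; then the prior estimates $\overline x_{k+1,i}=\hat f(\hat x_{k,i})+a\sum_{j\in\mathcal N_i}\pi_{ij}G\hat x_{k,j}$ and $\overline x^u_{k+1,i}=\overline x_{k+1,i}-\overline\lambda_{k,i}(F_{k,i}+a\pi_{ii}G)P_{k,i}\hat x_{k,i}/(1-\alpha_{k,i})$; then the posterior estimate $$\hat x_{k+1,i}=(1-\alpha_{k,i})[\overline x_{k+1,i}^u+K_{1,k+1,i}b_{k+1,i}^u]+\alpha_{k,i}\overline x_{k+1,i}+\sum_{j\in\mathcal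 N_i,j\ne i}\frac{\alpha_{k,i}K_{2,k+1,ij}b_{k+1,i}}{\sum_{l\in\mathcal N_i,l\neq i}\pi_{il}},$$ where $b_{k+1,i}=y_{k+1,i}-H_i\overline x_{k+1,i}$, $b^u_{k+1,i}=y_{k+1,i}-H_i\overline x^u_{k+1,i}$, $K_{1,k+1,i}=(\breve P_{k+1,i}^{-1}+H_i^T\hat R_{k+1,i}^{-1}H_i+2\overline\lambda_{k,i}I_n)^{-1}H_i^T\hat R_{k+1,i}^{-1}$, $K_{2,k+1,ij}=a\pi_{ij}G(P_{k,j}^{-1}+G^TH_i^TZ_{k,ij}H_iG)^{-1}G^TH_i^TZ_{k,ij}$. Matrix products and inverses are counted with the standard cubic cost.
   Formalization: Assumes E has at most c·n columns and that evaluating f̂ or its Jacobian costs at most c·n³ (c arbitrary, O-constant depends on c); without this the bound fails or is undefined. The products K₂b are computed without forming each Z_ij and K₂,ij. *)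

theory Defs
  imports Complex_Main "Jordan_Normal_Form.Gauss_Jordan_Elimination"
begin

section \<open>Matrices\<close>

text \<open>
  Dimensions vary inside the statement, so matrices have the type \<^typ>\<open>real mat\<close>.
  Elements of $R^m$ are columns in \<open>carrier_mat m 1\<close>, scalars handled by a program are
  matrices in \<open>carrier_mat 1 1\<close>.
\<close>

text \<open>The inverse is made total in the same way as \<open>x / 0 = 0\<close> is for real numbers.\<close>

definition inv_mat :: "real mat \<Rightarrow> real mat" where
  "inv_mat A = (case mat_inverse A of Some B \<Rightarrow> B | None \<Rightarrow> 0\<^sub>m (dim_row A) (dim_col A))"

definition pos_def_mat :: "nat \<Rightarrow> real mat \<Rightarrow> bool" where
  "pos_def_mat m A \<longleftrightarrow> A \<in> carrier_mat m m \<and> transpose_mat A = A \<and>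
     (\<forall>v \<in> carrier_vec m. v \<noteq> 0\<^sub>v m \<longrightarrow> 0 < v \<bullet> (A *\<^sub>v v))"

definition msum :: "nat \<Rightarrow> nat \<Rightarrow> ('b \<Rightarrow> real mat) \<Rightarrow> 'b set \<Rightarrow> real mat" where
  "msum m l f A = mat m l (\<lambda>(p, q). \<Sum>j\<in>A. f j $$ (p, q))"

definition scalar_mat :: "real \<Rightarrow> real mat" where
  "scalar_mat c = mat 1 1 (\<lambda>_. c)"

definition is_jacobian :: "nat \<Rightarrow> (real mat \<Rightarrow> real mat) \<Rightarrow> real mat \<Rightarrow> real mat \<Rightarrow> bool" where
  "is_jacobian m f x D \<longleftrightarrow> D \<in> carrier_mat m m \<and>
     (\<forall>p<m. \<forall>q<m.
        ((\<lambda>t. f (mat m 1 (\<lambda>(l, _). x $$ (l, 0) + (if l = q then t else 0))) $$ (p, 0))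
           has_real_derivative D $$ (p, q)) (at 0))"


section \<open>Network and algorithm\<close>

text \<open>
  Fields with a step argument \<open>k\<close> and a node argument \<open>i\<close> (in this order) are the
  corresponding doubly indexed quantities. \<open>fhat'\<close> maps a state to the Jacobian of \<open>fhat\<close>
  at that state; \<open>xhat k i\<close> and \<open>Pcov k i\<close> are the estimate and covariance that node \<open>i\<close>
  holds at step \<open>k\<close>.
\<close>

record network =
  nodes :: nat
  sdim :: nat
  mdim :: nat
  nbrs :: "nat \<Rightarrow> nat set"
  cstr :: real
  wgt :: "nat \<Rightarrow> nat \<Rightarrow> real"
  fhat :: "real mat \<Rightarrow> real mat"
  fhat' :: "real mat \<Rightarrow> real mat"
  Gm :: "real mat"
  Hm :: "nat \<Rightarrow> real mat"
  Qm :: "nat \<Rightarrow> nat \<Rightarrow> real mat"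
  Rm :: "nat \<Rightarrow> nat \<Rightarrow> real mat"
  Em :: "nat \<Rightarrow> nat \<Rightarrow> real mat"
  lam :: "nat \<Rightarrow> nat \<Rightarrow> real"
  alp :: "nat \<Rightarrow> nat \<Rightarrow> real"
  meas :: "nat \<Rightarrow> nat \<Rightarrow> real mat"
  xhat :: "nat \<Rightarrow> nat \<Rightarrow> real mat"
  Pcov :: "nat \<Rightarrow> nat \<Rightarrow> real mat"

text \<open>
  The number of columns of \<open>Em S k i\<close>, which is the horizontal concatenation of the two
  uncertainty matrices, is left open here.
\<close>

definition valid_network :: "network \<Rightarrow> bool" where
  "valid_network S \<longleftrightarrow>
     (let V = {1..nodes S}; n = sdim S; r = mdim S in
       0 < cstr S \<and>
       (\<forall>i\<in>V. nbrs S i \<subseteq> V \<and> i \<in> nbrs S i) \<and>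
       (\<forall>i\<in>V. \<forall>j\<in>V. wgt S i j \<noteq> 0 \<longleftrightarrow> j \<in> nbrs S i) \<and>
       (\<forall>x\<in>carrier_mat n 1. fhat S x \<in> carrier_mat n 1 \<and> is_jacobian n (fhat S) x (fhat' S x)) \<and>
       Gm S \<in> carrier_mat n n \<and>
       (\<forall>k. \<forall>i\<in>V.
          Hm S i \<in> carrier_mat r n \<and>
          pos_def_mat n (Qm S k i) \<and> pos_def_mat r (Rm S k i) \<and>
          dim_row (Em S k i) = n \<and>
          0 \<le> alp S k i \<and> alp S k i \<le> 1 \<and>
          meas S k i \<in> carrier_mat r 1 \<and>
          xhat S k i \<in> carrier_mat n 1 \<and>
          Pcov S k i \<in> carrier_mat n n))"

context
  fixes S :: network and k i :: nat
begin

definition F_plus_G :: "real mat" where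
  "F_plus_G = fhat' S (xhat S k i) + (cstr S * wgt S i i) \<cdot>\<^sub>m Gm S"

definition P_breve :: "real mat" where
  "P_breve = F_plus_G * Pcov S k i * transpose_mat F_plus_G + Qm S k i"

definition R_hat :: "real mat" where
  "R_hat = inverse (1 + cstr S) \<cdot>\<^sub>m Rm S (k + 1) i -
     inverse (lam S k i) \<cdot>\<^sub>m
       (Hm S i * Em S k i * transpose_mat (Em S k i) * transpose_mat (Hm S i))"

definition Z_mat :: "nat \<Rightarrow> real mat" where
  "Z_mat j = ((wgt S i j)\<^sup>2 * (cstr S + (cstr S)\<^sup>2) * (real (nodes S) - 1)) \<cdot>\<^sub>m inv_mat (Rm S (k + 1) i)"

definition own_cov :: "real mat" where
  "own_cov = inv_mat (inv_mat P_breve + transpose_mat (Hm S i) * inv_mat R_hat * Hm S i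
     + (2 * lam S k i) \<cdot>\<^sub>m 1\<^sub>m (sdim S))"

definition nbr_cov :: "nat \<Rightarrow> real mat" where
  "nbr_cov j = inv_mat (inv_mat (Pcov S k j)
     + transpose_mat (Gm S) * transpose_mat (Hm S i) * Z_mat j * Hm S i * Gm S)"

definition P_next :: "real mat" where
  "P_next = (1 + cstr S) \<cdot>\<^sub>m own_cov
     + ((cstr S + (cstr S)\<^sup>2) * (real (nodes S) - 1)) \<cdot>\<^sub>m
         msum (sdim S) (sdim S)
           (\<lambda>j. (wgt S i j)\<^sup>2 \<cdot>\<^sub>m (Gm S * nbr_cov j * transpose_mat (Gm S))) (nbrs S i - {i})"

definition x_prior :: "real mat" where
  "x_prior = fhat S (xhat S k i)
     + cstr S \<cdot>\<^sub>m msum (sdim S) 1 (\<lambda>j. wgt S i j \<cdot>\<^sub>m (Gm S * xhat S k j)) (nbrs S i)"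

definition x_prior_u :: "real mat" where
  "x_prior_u = x_prior
     - (lam S k i / (1 - alp S k i)) \<cdot>\<^sub>m (F_plus_G * Pcov S k i * xhat S k i)"

definition innov :: "real mat" where
  "innov = meas S (k + 1) i - Hm S i * x_prior"

definition innov_u :: "real mat" where
  "innov_u = meas S (k + 1) i - Hm S i * x_prior_u"

definition K1 :: "real mat" where
  "K1 = own_cov * transpose_mat (Hm S i) * inv_mat R_hat"

definition K2 :: "nat \<Rightarrow> real mat" where
  "K2 j = (cstr S * wgt S i j) \<cdot>\<^sub>m
     (Gm S * nbr_cov j * transpose_mat (Gm S) * transpose_mat (Hm S i) * Z_mat j)"

definition x_post :: "real mat" where
  "x_post = (1 - alp S k i) \<cdot>\<^sub>m (x_prior_u + K1 * innov_u) + alp S k i \<cdot>\<^sub>m x_prior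
     + msum (sdim S) 1
         (\<lambda>j. (alp S k i / (\<Sum>l\<in>nbrs S i - {i}. wgt S i l)) \<cdot>\<^sub>m (K2 j * innov)) (nbrs S i - {i})"

end


section \<open>Straight-line matrix programs and their operation count\<close>

text \<open>
  \<open>Nbr_Gain_Innov j\<close> is the product of the gain \<open>K2 j\<close> with the innovation. The matrices
  \<open>Z_mat j\<close> and \<open>K2 j\<close> themselves are not among the computed quantities: writing down all of
  their entries for every neighbour would already take a number of operations proportional
  to the number of neighbours times \<open>r\<^sup>2\<close> and \<open>n * r\<close>, respectively.
\<close>

datatype quantity =
    Breve_Cov | Noise_Cov_Hat | Own_Cov | Nbr_Cov nat | Next_Cov
  | Prior | Prior_U | Innov | Innov_U | Own_Gain | Nbr_Gain_Innov nat | Posterior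

fun quantity_value :: "network \<Rightarrow> nat \<Rightarrow> nat \<Rightarrow> quantity \<Rightarrow> real mat" where
  "quantity_value S k i Breve_Cov = P_breve S k i"
| "quantity_value S k i Noise_Cov_Hat = R_hat S k i"
| "quantity_value S k i Own_Cov = own_cov S k i"
| "quantity_value S k i (Nbr_Cov j) = nbr_cov S k i j"
| "quantity_value S k i Next_Cov = P_next S k i"
| "quantity_value S k i Prior = x_prior S k i"
| "quantity_value S k i Prior_U = x_prior_u S k i"
| "quantity_value S k i Innov = innov S k i"
| "quantity_value S k i Innov_U = innov_u S k i"
| "quantity_value S k i Own_Gain = K1 S k i"
| "quantity_value S k i (Nbr_Gain_Innov j) = K2 S k i j * innov S k i"
| "quantity_value S k i Posterior = x_post S k i"

definition step_quantities :: "nat \<Rightarrow> nat set \<Rightarrow> quantity set" where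
  "step_quantities i Nb =
     {Breve_Cov, Noise_Cov_Hat, Own_Cov, Next_Cov, Prior, Prior_U, Innov, Innov_U, Own_Gain, Posterior}
     \<union> Nbr_Cov ` (Nb - {i}) \<union> Nbr_Gain_Innov ` (Nb - {i})"

datatype loc =
    In_Meas | In_Est nat | In_Cov nat | In_Wgt nat | In_Cstr | In_G | In_H | In_Q | In_R | In_E
  | In_Lam | In_Alp | Out quantity | Tmp nat

type_synonym store = "loc \<Rightarrow> real mat option"

text \<open>What node \<open>i\<close> knows at the start of step \<open>k + 1\<close> before the computation; everything else is undefined.\<close>

definition init_store :: "network \<Rightarrow> nat \<Rightarrow> nat \<Rightarrow> store" where
  "init_store S k i v = (case v of
       In_Meas \<Rightarrow> Some (meas S (k + 1) i)
     | In_Est j \<Rightarrow> (if j \<in> nbrs S i then Some (xhat S k j) else None)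
     | In_Cov j \<Rightarrow> (if j \<in> nbrs S i then Some (Pcov S k j) else None)
     | In_Wgt j \<Rightarrow> (if j \<in> nbrs S i then Some (scalar_mat (wgt S i j)) else None)
     | In_Cstr \<Rightarrow> Some (scalar_mat (cstr S))
     | In_G \<Rightarrow> Some (Gm S)
     | In_H \<Rightarrow> Some (Hm S i)
     | In_Q \<Rightarrow> Some (Qm S k i)
     | In_R \<Rightarrow> Some (Rm S (k + 1) i)
     | In_E \<Rightarrow> Some (Em S k i)
     | In_Lam \<Rightarrow> Some (scalar_mat (lam S k i))
     | In_Alp \<Rightarrow> Some (scalar_mat (alp S k i))
     | Out q \<Rightarrow> None
     | Tmp t \<Rightarrow> None)"

text \<open>\<open>Eval_f\<close> and \<open>Eval_J\<close> evaluate the system function and its Jacobian at a state.\<close>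

datatype opr =
    Const real | Ident nat
  | Add loc loc | Sub loc loc | Mul loc loc | Scale loc loc
  | Transp loc | Inv loc
  | Eval_f loc | Eval_J loc

datatype instr = Assign loc opr

text \<open>
  \<open>exec_opr f J cf cJ op s\<close> is the resulting matrix together with the number of arithmetic
  operations, or \<^term>\<open>None\<close> if an operand is undefined or has the wrong shape. A product
  of an $m \times p$ by a $p \times l$ matrix takes $m l p$ multiplications and $m l (p - 1)$
  additions, Gauss-Jordan inversion of an $m \times m$ matrix at most $2 m^3$ operations. Loading
  constants and transposing are not arithmetic operations. One evaluation of \<open>f\<close> counts
  as \<open>cf\<close>, one of \<open>J\<close> as \<open>cJ\<close> operations.
\<close>

definition exec_opr ::
  "(real mat \<Rightarrow> real mat) \<Rightarrow> (real mat \<Rightarrow> real mat) \<Rightarrow> nat \<Rightarrow> nat \<Rightarrow> opr \<Rightarrow> store \<Rightarrow> (real mat \<times> nat) option"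
where
  "exec_opr f J cf cJ op s = (case op of
       Const c \<Rightarrow> Some (scalar_mat c, 0)
     | Ident m \<Rightarrow> Some (1\<^sub>m m, 0)
     | Add u v \<Rightarrow> (case (s u, s v) of (Some A, Some B) \<Rightarrow>
           (if dim_row A = dim_row B \<and> dim_col A = dim_col B
            then Some (A + B, dim_row A * dim_col A) else None) | _ \<Rightarrow> None)
     | Sub u v \<Rightarrow> (case (s u, s v) of (Some A, Some B) \<Rightarrow>
           (if dim_row A = dim_row B \<and> dim_col A = dim_col B
            then Some (A - B, dim_row A * dim_col A) else None) | _ \<Rightarrow> None)
     | Mul u v \<Rightarrow> (case (s u, s v) of (Some A, Some B) \<Rightarrow>
           (if dim_col A = dim_row B
            then Some (A * B, dim_row A * dim_col B * (2 * dim_col A - 1)) else None) | _ \<Rightarrow> None)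
     | Scale u v \<Rightarrow> (case (s u, s v) of (Some A, Some B) \<Rightarrow>
           (if A \<in> carrier_mat 1 1
            then Some ((A $$ (0, 0)) \<cdot>\<^sub>m B, dim_row B * dim_col B) else None) | _ \<Rightarrow> None)
     | Transp u \<Rightarrow> (case s u of Some A \<Rightarrow> Some (transpose_mat A, 0) | None \<Rightarrow> None)
     | Inv u \<Rightarrow> (case s u of Some A \<Rightarrow>
           (if dim_row A = dim_col A then Some (inv_mat A, 2 * dim_row A ^ 3) else None) | None \<Rightarrow> None)
     | Eval_f u \<Rightarrow> (case s u of Some A \<Rightarrow> Some (f A, cf) | None \<Rightarrow> None)
     | Eval_J u \<Rightarrow> (case s u of Some A \<Rightarrow> Some (J A, cJ) | None \<Rightarrow> None))"

fun run ::
  "(real mat \<Rightarrow> real mat) \<Rightarrow> (real mat \<Rightarrow> real mat) \<Rightarrow> nat \<Rightarrow> nat \<Rightarrow> instr list \<Rightarrow> store \<Rightarrow> (store \<times> nat) option"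
where
  "run f J cf cJ [] s = Some (s, 0)"
| "run f J cf cJ (Assign v op # is) s =
     (case exec_opr f J cf cJ op s of
        None \<Rightarrow> None
      | Some (A, c) \<Rightarrow>
          (case run f J cf cJ is (s(v \<mapsto> A)) of
             None \<Rightarrow> None
           | Some (t, d) \<Rightarrow> Some (t, c + d)))"

end

theory Submission
  imports Defs
begin

text \<open>
  Inverting the matrices of size $r$ and multiplying matrices with dimensions $n$ and $r$ must not
  be repeated for every neighbour. This is possible because $Z_{k,ij}$ depends on $j$ only through
  a scalar factor $\zeta_j$: with $W = G^T H_i^T R_{k+1,i}^{-1} H_i G$ and
  $u = G^T H_i^T R_{k+1,i}^{-1} b_{k+1,i}$, both computed once at cost $O(n^3 + r^3)$, the
  information matrix of neighbour $j$ is $P_{k,j}^{-1} + \zeta_j W$, and its gain applied to the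
  innovation is a multiple of $G (P_{k,j}^{-1} + \zeta_j W)^{-1} u$. Hence every neighbour costs
  $O(n^3)$.
\<close>

section \<open>Matrix facts\<close>

text \<open>Every instruction that costs anything is charged the same price,
  \<open>2 * D ^ 3\<close> for matrices with both dimensions at most \<open>D\<close>. One size
  \<open>D\<close> of order max(n, r) for the whole program would only give card(Nb) (n^3 + r^3),
  because the number of instructions grows with the number of neighbours. The computation is
  therefore cut into four blocks priced with two sizes: the two blocks with a fixed number of
  instructions may handle dimension r, the two that loop over neighbours only dimensions of order n.
  This is why W, u and the correction \<open>K1 * innov_u\<close>, none of which has a dimension r,
  are stored before the loops that use them. The factor c + 1 in the sizes absorbs the up to c n
  columns of E and the up to c n^3 operations of an evaluation of f or its Jacobian. Denominators
  may vanish (alpha = 1, weights summing to 0), so all identities are proved for the total inverse,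
  from linearity, associativity and \<open>inverse 0 = 0\<close>.\<close>

lemma inv_mat_carrier:
  assumes "A \<in> carrier_mat m m"
  shows "inv_mat A \<in> carrier_mat m m"
  using assms mat_inverse(2)[OF assms] by (auto simp: inv_mat_def split: option.split)

lemma dim_inv_mat [simp]:
  assumes "dim_row A = dim_col A"
  shows "dim_row (inv_mat A) = dim_col A" "dim_col (inv_mat A) = dim_col A"
proof -
  have "inv_mat A \<in> carrier_mat (dim_col A) (dim_col A)"
    by (rule inv_mat_carrier) (rule carrier_matI[OF assms refl])
  then show "dim_row (inv_mat A) = dim_col A" "dim_col (inv_mat A) = dim_col A"
    by (rule carrier_matD)+
qed

lemma dim_scalar_mat [simp]: "dim_row (scalar_mat x) = 1" "dim_col (scalar_mat x) = 1"
  by (simp_all add: scalar_mat_def)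

lemma scalar_mat_carrier [simp]: "scalar_mat x \<in> carrier_mat 1 1"
  by (simp add: scalar_mat_def)

lemma scalar_mat_index [simp]: "scalar_mat x $$ (0, 0) = x"
  by (simp add: scalar_mat_def)

text \<open>Programs hold scalars as 1 by 1 matrices; together with \<open>inv_scalar_mat\<close>
  these rules turn their matrix arithmetic back into real arithmetic.\<close>

lemma scalar_mat_arith [simp]:
  "scalar_mat x + scalar_mat y = scalar_mat (x + y)"
  "scalar_mat x - scalar_mat y = scalar_mat (x - y)"
  "scalar_mat x * scalar_mat y = scalar_mat (x * y)"
  by (rule eq_matI; simp add: scalar_mat_def scalar_prod_def)+

lemma one_mat_eq_scalar_mat: "1\<^sub>m 1 = scalar_mat 1"
  by (rule eq_matI) (auto simp: scalar_mat_def)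

text \<open>Division of scalars has no instruction of its own and is done by inverting a 1 by 1
  matrix. If inversion fails then x = 0, as otherwise \<open>scalar_mat (inverse x)\<close> would be
  an inverse; the zero matrix that \<open>inv_mat\<close> then returns agrees with
  \<open>inverse 0 = 0\<close>. Hence vanishing denominators need no case distinction later.\<close>

lemma inv_scalar_mat [simp]: "inv_mat (scalar_mat x) = scalar_mat (inverse x)"
proof (cases "mat_inverse (scalar_mat x)")
  case None
  have "x = 0"
  proof (rule ccontr)
    assume "x \<noteq> 0"
    then have "scalar_mat x \<in> Units (ring_mat TYPE(real) 1 b)" for b :: unit
      unfolding Units_def ring_mat_simps
      by (auto intro!: bexI[of _ "scalar_mat (inverse x)"] simp: one_mat_eq_scalar_mat)
    with mat_inverse(1)[OF scalar_mat_carrier None, of "()"] show False by blast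
  qed
  then show ?thesis
    using None by (auto simp: inv_mat_def scalar_mat_def intro!: eq_matI)
next
  case (Some B)
  from mat_inverse(2)[OF scalar_mat_carrier Some]
  have B: "scalar_mat x * B = 1\<^sub>m 1" "B \<in> carrier_mat 1 1" by auto
  have B_eq: "B = scalar_mat (B $$ (0, 0))"
    using B(2) by (intro eq_matI) (auto simp: scalar_mat_def)
  have "scalar_mat (x * B $$ (0, 0)) = scalar_mat 1"
    using B(1) B_eq by (metis scalar_mat_arith(3) one_mat_eq_scalar_mat)
  then have "x * B $$ (0, 0) = 1"
    by (metis scalar_mat_index)
  then have "B $$ (0, 0) = inverse x"
    by (metis inverse_unique)
  with B_eq Some show ?thesis
    by (simp add: inv_mat_def)
qed

lemma dim_msum [simp]: "dim_row (msum m l f A) = m" "dim_col (msum m l f A) = l"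
  by (simp_all add: msum_def)

lemma msum_empty: "msum m l f {} = 0\<^sub>m m l"
  by (rule eq_matI) (auto simp: msum_def)

lemma msum_insert:
  assumes "finite A" "a \<notin> A" "f a \<in> carrier_mat m l"
  shows "msum m l f (insert a A) = f a + msum m l f A"
  using assms by (intro eq_matI) (auto simp: msum_def)

lemma msum_scalar_mat: "msum 1 1 (\<lambda>j. scalar_mat (w j)) A = scalar_mat (sum w A)"
  by (rule eq_matI) (auto simp: msum_def scalar_mat_def)

lemma smult_smult_mat: "x \<cdot>\<^sub>m (y \<cdot>\<^sub>m A) = (x * y) \<cdot>\<^sub>m (A :: real mat)"
  by (rule eq_matI) (auto simp: mult.assoc)

lemma zero_smult_mat [simp]: "0 \<cdot>\<^sub>m A = 0\<^sub>m (dim_row A) (dim_col (A :: real mat))"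
  by (rule eq_matI) auto

lemma msum_cong: "(\<And>j. j \<in> A \<Longrightarrow> f j = g j) \<Longrightarrow> msum m l f A = msum m l g A"
  by (simp add: msum_def cong: sum.cong)


section \<open>Matrix expressions and their compilation\<close>

datatype expr =
    Loc loc
  | Num real
  | One nat
  | Plus expr expr (infixl "[+]" 65)
  | Minus expr expr (infixl "[-]" 65)
  | Times expr expr (infixl "[*]" 70)
  | Smult expr expr (infixr "[\<cdot>]" 75)
  | Transposed expr
  | Inverse expr
  | App_f expr
  | App_J expr

fun leaves :: "expr \<Rightarrow> loc set" where
  "leaves (Loc x) = {x}"
| "leaves (Num a) = {}"
| "leaves (One m) = {}"
| "leaves (d [+] e) = leaves d \<union> leaves e"
| "leaves (d [-] e) = leaves d \<union> leaves e"
| "leaves (d [*] e) = leaves d \<union> leaves e"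
| "leaves (d [\<cdot>] e) = leaves d \<union> leaves e"
| "leaves (Transposed e) = leaves e"
| "leaves (Inverse e) = leaves e"
| "leaves (App_f e) = leaves e"
| "leaves (App_J e) = leaves e"

text \<open>Counts the nodes whose instruction \<open>exec_opr\<close> may charge for. Constants,
  identities and transposes are free, and so are leaves, which are copied by transposing.\<close>

fun nops :: "expr \<Rightarrow> nat" where
  "nops (Loc x) = 0"
| "nops (Num a) = 0"
| "nops (One m) = 0"
| "nops (d [+] e) = nops d + nops e + 1"
| "nops (d [-] e) = nops d + nops e + 1"
| "nops (d [*] e) = nops d + nops e + 1"
| "nops (d [\<cdot>] e) = nops d + nops e + 1"
| "nops (Transposed e) = nops e"
| "nops (Inverse e) = nops e + 1"
| "nops (App_f e) = nops e + 1"
| "nops (App_J e) = nops e + 1"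

definition scratch :: "nat \<Rightarrow> loc set" where
  "scratch t = Tmp ` {t..}"

lemma Tmp_in_scratch [simp]: "Tmp u \<in> scratch t \<longleftrightarrow> t \<le> u"
  by (auto simp: scratch_def)

lemma scratch_rec: "scratch t = insert (Tmp t) (scratch (Suc t))"
proof -
  have "{t..} = insert t {Suc t..}" by auto
  then show ?thesis by (simp add: scratch_def)
qed

text \<open>There is no copy instruction; transposing twice copies at no cost.\<close>

fun compile :: "loc \<Rightarrow> nat \<Rightarrow> expr \<Rightarrow> instr list" where
  "compile v t (Loc x) = [Assign v (Transp x), Assign v (Transp v)]"
| "compile v t (Num a) = [Assign v (Const a)]"
| "compile v t (One m) = [Assign v (Ident m)]"
| "compile v t (d [+] e) =
     compile (Tmp t) (t + 1) d @ compile (Tmp (t + 1)) (t + 2) e @ [Assign v (Add (Tmp t) (Tmp (t + 1)))]"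
| "compile v t (d [-] e) =
     compile (Tmp t) (t + 1) d @ compile (Tmp (t + 1)) (t + 2) e @ [Assign v (Sub (Tmp t) (Tmp (t + 1)))]"
| "compile v t (d [*] e) =
     compile (Tmp t) (t + 1) d @ compile (Tmp (t + 1)) (t + 2) e @ [Assign v (Mul (Tmp t) (Tmp (t + 1)))]"
| "compile v t (d [\<cdot>] e) =
     compile (Tmp t) (t + 1) d @ compile (Tmp (t + 1)) (t + 2) e @ [Assign v (Scale (Tmp t) (Tmp (t + 1)))]"
| "compile v t (Transposed e) = compile (Tmp t) (t + 1) e @ [Assign v (Transp (Tmp t))]"
| "compile v t (Inverse e) = compile (Tmp t) (t + 1) e @ [Assign v (Inv (Tmp t))]"
| "compile v t (App_f e) = compile (Tmp t) (t + 1) e @ [Assign v (Eval_f (Tmp t))]"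
| "compile v t (App_J e) = compile (Tmp t) (t + 1) e @ [Assign v (Eval_J (Tmp t))]"

definition compile_all :: "nat \<Rightarrow> (loc \<times> expr) list \<Rightarrow> instr list" where
  "compile_all t as = concat (map (\<lambda>(v, e). compile v t e) as)"

text \<open>The base \<open>z\<close> is meant to be a zero matrix: it fixes the shape of the sum
  when there is no neighbour, at the price of one addition per summand.\<close>

definition sum_expr :: "expr \<Rightarrow> ('b \<Rightarrow> expr) \<Rightarrow> 'b list \<Rightarrow> expr" where
  "sum_expr z g js = foldr (\<lambda>j e. g j [+] e) js z"

lemma leaves_sum_expr [simp]: "leaves (sum_expr z g js) = leaves z \<union> (\<Union>j\<in>set js. leaves (g j))"
  by (induction js) (auto simp: sum_expr_def)

lemma nops_sum_expr [simp]:
  assumes "\<And>j. nops (g j) = b"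
  shows "nops (sum_expr z g js) = nops z + length js * (b + 1)"
  using assms by (induction js) (auto simp: sum_expr_def)

section \<open>Semantics and cost of compiled expressions\<close>

locale evaluation =
  fixes f J :: "real mat \<Rightarrow> real mat" and cf cJ :: nat
begin

lemma run_append:
  "run f J cf cJ (p @ q) s =
     (case run f J cf cJ p s of
        None \<Rightarrow> None
      | Some (s', a) \<Rightarrow>
          (case run f J cf cJ q s' of
             None \<Rightarrow> None
           | Some (t, b) \<Rightarrow> Some (t, a + b)))"
proof (induction p arbitrary: s)
  case Nil
  then show ?case by (auto split: option.split)
next
  case (Cons ins p)
  show ?case
  proof (cases ins)
    case (Assign v op)
    show ?thesis
    proof (cases "exec_opr f J cf cJ op s")
      case (Some Aa)
      obtain A a where "Aa = (A, a)" by fastforce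
      then show ?thesis
        using Some Assign Cons[of "s(v \<mapsto> A)"]
        by (cases "run f J cf cJ p (s(v \<mapsto> A))") (auto simp del: fun_upd_apply split: option.splits)
    qed (simp add: Assign)
  qed
qed

fun val :: "(loc \<Rightarrow> real mat) \<Rightarrow> expr \<Rightarrow> real mat" where
  "val V (Loc x) = V x"
| "val V (Num a) = scalar_mat a"
| "val V (One m) = 1\<^sub>m m"
| "val V (d [+] e) = val V d + val V e"
| "val V (d [-] e) = val V d - val V e"
| "val V (d [*] e) = val V d * val V e"
| "val V (d [\<cdot>] e) = val V d $$ (0, 0) \<cdot>\<^sub>m val V e"
| "val V (Transposed e) = transpose_mat (val V e)"
| "val V (Inverse e) = inv_mat (val V e)"
| "val V (App_f e) = f (val V e)"
| "val V (App_J e) = J (val V e)"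

text \<open>All matrices that occur are of size at most \<open>D\<close>, so every operation costs at most \<open>2 * D ^ 3\<close>.\<close>

definition small :: "nat \<Rightarrow> real mat \<Rightarrow> bool" where
  "small D A \<longleftrightarrow> dim_row A \<le> D \<and> dim_col A \<le> D"

text \<open>Sizes are tested only at the leaves and at evaluations of \<open>f\<close> and
  \<open>J\<close>, whose results are not controlled by their arguments; every other operation
  yields dimensions already present in its operands. The bounds on \<open>cf\<close> and
  \<open>cJ\<close> make an evaluation no dearer than a matrix operation, so one price fits all
  nodes.\<close>

fun shaped :: "nat \<Rightarrow> (loc \<Rightarrow> real mat) \<Rightarrow> expr \<Rightarrow> bool" where
  "shaped D V (Loc x) \<longleftrightarrow> small D (V x)"
| "shaped D V (Num a) \<longleftrightarrow> 1 \<le> D"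
| "shaped D V (One m) \<longleftrightarrow> m \<le> D"
| "shaped D V (d [+] e) \<longleftrightarrow> shaped D V d \<and> shaped D V e \<and>
     dim_row (val V d) = dim_row (val V e) \<and> dim_col (val V d) = dim_col (val V e)"
| "shaped D V (d [-] e) \<longleftrightarrow> shaped D V d \<and> shaped D V e \<and>
     dim_row (val V d) = dim_row (val V e) \<and> dim_col (val V d) = dim_col (val V e)"
| "shaped D V (d [*] e) \<longleftrightarrow> shaped D V d \<and> shaped D V e \<and>
     dim_col (val V d) = dim_row (val V e)"
| "shaped D V (d [\<cdot>] e) \<longleftrightarrow> shaped D V d \<and> shaped D V e \<and>
     dim_row (val V d) = 1 \<and> dim_col (val V d) = 1"
| "shaped D V (Transposed e) \<longleftrightarrow> shaped D V e"
| "shaped D V (Inverse e) \<longleftrightarrow> shaped D V e \<and> dim_row (val V e) = dim_col (val V e)"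
| "shaped D V (App_f e) \<longleftrightarrow> shaped D V e \<and> small D (f (val V e)) \<and> cf \<le> 2 * D ^ 3"
| "shaped D V (App_J e) \<longleftrightarrow> shaped D V e \<and> small D (J (val V e)) \<and> cJ \<le> 2 * D ^ 3"

lemma small_val: "shaped D V e \<Longrightarrow> small D (val V e)"
  by (induction e) (auto simp: small_def)

lemma small_cost:
  assumes "small D A" "small D B"
  shows "dim_row A * dim_col A \<le> 2 * D ^ 3"
    and "dim_row A * dim_col B * (2 * dim_col A - 1) \<le> 2 * D ^ 3"
    and "2 * dim_row A ^ 3 \<le> 2 * D ^ 3"
proof -
  have le: "dim_row A \<le> D" "dim_col A \<le> D" "dim_row B \<le> D" "dim_col B \<le> D"
    using assms by (auto simp: small_def)
  have "dim_row A * dim_col A \<le> D * D"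
    by (intro mult_le_mono le)
  also have "\<dots> \<le> 2 * D ^ 3"
    by (cases D) (auto simp: power3_eq_cube)
  finally show "dim_row A * dim_col A \<le> 2 * D ^ 3" .
  have "dim_row A * dim_col B * (2 * dim_col A - 1) \<le> D * D * (2 * D)"
    using le by (intro mult_le_mono) auto
  then show "dim_row A * dim_col B * (2 * dim_col A - 1) \<le> 2 * D ^ 3"
    by (simp add: power3_eq_cube mult_ac)
  show "2 * dim_row A ^ 3 \<le> 2 * D ^ 3"
    using le by (simp add: power_mono)
qed

text \<open>Quantifying over \<open>v\<close>, \<open>t\<close> and \<open>s\<close> and including
  the frame condition make the induction over expressions work: subexpressions run from altered
  stores, with other targets, and must leave earlier results alone.\<close>

definition compiles :: "(loc \<Rightarrow> real mat) \<Rightarrow> expr \<Rightarrow> real mat \<Rightarrow> nat \<Rightarrow> bool" where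
  "compiles V e A b \<longleftrightarrow> (\<forall>v t s. leaves e \<inter> scratch t = {} \<longrightarrow> (\<forall>x\<in>leaves e. s x = Some (V x)) \<longrightarrow>
     (\<exists>s' a. run f J cf cJ (compile v t e) s = Some (s', a) \<and> s' v = Some A \<and>
        (\<forall>x. x \<noteq> v \<and> x \<notin> scratch t \<longrightarrow> s' x = s x) \<and> a \<le> b))"

lemma compilesE:
  assumes "compiles V e A b" "leaves e \<inter> scratch t = {}" "\<And>x. x \<in> leaves e \<Longrightarrow> s x = Some (V x)"
  obtains s' a where "run f J cf cJ (compile v t e) s = Some (s', a)" "s' v = Some A"
    "\<And>x. x \<noteq> v \<Longrightarrow> x \<notin> scratch t \<Longrightarrow> s' x = s x" "a \<le> b"
proof -
  have "\<exists>s' a. run f J cf cJ (compile v t e) s = Some (s', a) \<and> s' v = Some A \<and>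
      (\<forall>x. x \<noteq> v \<and> x \<notin> scratch t \<longrightarrow> s' x = s x) \<and> a \<le> b"
    using assms(1)[unfolded compiles_def, rule_format, OF assms(2), of s v] assms(3) by blast
  then show thesis using that by blast
qed

lemma compiles_unary:
  assumes e: "compiles V e A b"
    and E: "\<And>v t. compile v t E = compile (Tmp t) (t + 1) e @ [Assign v (op (Tmp t))]" "leaves E = leaves e"
    and op: "\<And>x s. s x = Some A \<Longrightarrow> \<exists>a \<le> a'. exec_opr f J cf cJ (op x) s = Some (B, a)"
  shows "compiles V E B (b + a')"
  unfolding compiles_def
proof (intro allI impI)
  fix v t and s :: store
  assume leaves: "leaves E \<inter> scratch t = {}" and s: "\<forall>x\<in>leaves E. s x = Some (V x)"
  have scratch: "scratch t = insert (Tmp t) (scratch (t + 1))"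
    using scratch_rec[of t] by simp
  obtain s1 a1 where s1: "run f J cf cJ (compile (Tmp t) (t + 1) e) s = Some (s1, a1)"
    "s1 (Tmp t) = Some A" "\<And>x. x \<noteq> Tmp t \<Longrightarrow> x \<notin> scratch (t + 1) \<Longrightarrow> s1 x = s x" "a1 \<le> b"
    by (rule compilesE[OF e, of "t + 1" s "Tmp t"]) (use E leaves s scratch in auto)
  from op[of s1 "Tmp t"] s1(2) obtain a where a: "a \<le> a'" "exec_opr f J cf cJ (op (Tmp t)) s1 = Some (B, a)"
    by blast
  have "s1 x = s x" if "x \<notin> scratch t" for x
    using s1(3) that scratch by blast
  moreover have "run f J cf cJ (compile v t E) s = Some (s1(v \<mapsto> B), a1 + a)"
    using s1(1) a(2) by (simp add: E(1) run_append)
  ultimately show "\<exists>s' a. run f J cf cJ (compile v t E) s = Some (s', a) \<and> s' v = Some B \<and>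
      (\<forall>x. x \<noteq> v \<and> x \<notin> scratch t \<longrightarrow> s' x = s x) \<and> a \<le> b + a'"
    using s1(4) a(1) by (intro exI[of _ "s1(v \<mapsto> B)"] exI[of _ "a1 + a"]) auto
qed

text \<open>Once \<open>d\<close> is stored in \<open>Tmp t\<close>, its scratch cells from
  \<open>Tmp (t + 1)\<close> on are dead and are reused for \<open>e\<close>. The leaves of
  \<open>e\<close> are still intact because they lie outside \<open>scratch t\<close>. The shape of
  the compiled code is a premise so that one argument serves all four binary constructors.\<close>

lemma compiles_binary:
  assumes d: "compiles V d A b" and e: "compiles V e B b'"
    and E: "\<And>v t. compile v t E = compile (Tmp t) (t + 1) d @ compile (Tmp (t + 1)) (t + 2) e @
        [Assign v (op (Tmp t) (Tmp (t + 1)))]" "leaves E = leaves d \<union> leaves e"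
    and op: "\<And>x y s. s x = Some A \<Longrightarrow> s y = Some B \<Longrightarrow>
        \<exists>a \<le> a'. exec_opr f J cf cJ (op x y) s = Some (C, a)"
  shows "compiles V E C (b + b' + a')"
  unfolding compiles_def
proof (intro allI impI)
  fix v t and s :: store
  assume leaves: "leaves E \<inter> scratch t = {}" and s: "\<forall>x\<in>leaves E. s x = Some (V x)"
  have scratch: "scratch t = insert (Tmp t) (scratch (t + 1))"
    "scratch (t + 1) = insert (Tmp (t + 1)) (scratch (t + 2))"
    using scratch_rec[of t] scratch_rec[of "t + 1"] by simp_all
  obtain s1 a1 where s1: "run f J cf cJ (compile (Tmp t) (t + 1) d) s = Some (s1, a1)"
    "s1 (Tmp t) = Some A" "\<And>x. x \<noteq> Tmp t \<Longrightarrow> x \<notin> scratch (t + 1) \<Longrightarrow> s1 x = s x" "a1 \<le> b"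
    by (rule compilesE[OF d, of "t + 1" s "Tmp t"]) (use E leaves s scratch in auto)
  have s1_eq: "s1 x = s x" if "x \<notin> scratch t" for x
    using s1(3) that scratch by blast
  have "s1 x = Some (V x)" if "x \<in> leaves e" for x
  proof -
    have "x \<notin> scratch t" using that leaves E(2) by blast
    then show ?thesis using s1_eq s that E(2) by simp
  qed
  note s1_leaves = this
  obtain s2 a2 where s2: "run f J cf cJ (compile (Tmp (t + 1)) (t + 2) e) s1 = Some (s2, a2)"
    "s2 (Tmp (t + 1)) = Some B" "\<And>x. x \<noteq> Tmp (t + 1) \<Longrightarrow> x \<notin> scratch (t + 2) \<Longrightarrow> s2 x = s1 x"
    "a2 \<le> b'"
    by (rule compilesE[OF e, of "t + 2" s1 "Tmp (t + 1)"]) (use E(2) leaves scratch s1_leaves in auto)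
  \<comment> \<open>The left operand survives, since evaluating \<open>e\<close> writes only to
    \<open>Tmp (t + 1)\<close> and \<open>scratch (t + 2)\<close>.\<close>
  have "s2 (Tmp t) = Some A"
    using s2(3)[of "Tmp t"] s1(2) by simp
  with op[of s2 "Tmp t" "Tmp (t + 1)"] s2(2)
  obtain a where a: "a \<le> a'" "exec_opr f J cf cJ (op (Tmp t) (Tmp (t + 1))) s2 = Some (C, a)"
    by blast
  have "s2 x = s x" if "x \<notin> scratch t" for x
    using s1_eq s2(3) that scratch by (metis insertCI)
  moreover have "run f J cf cJ (compile v t E) s = Some (s2(v \<mapsto> C), a1 + (a2 + a))"
    using s1(1) s2(1) a(2) by (simp add: E(1) run_append)
  ultimately show "\<exists>s' a. run f J cf cJ (compile v t E) s = Some (s', a) \<and> s' v = Some C \<and>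
      (\<forall>x. x \<noteq> v \<and> x \<notin> scratch t \<longrightarrow> s' x = s x) \<and> a \<le> b + b' + a'"
    using s1(4) s2(4) a(1)
    by (intro exI[of _ "s2(v \<mapsto> C)"] exI[of _ "a1 + (a2 + a)"]) auto
qed

lemma compiles_val: "shaped D V e \<Longrightarrow> compiles V e (val V e) (nops e * (2 * D ^ 3))"
proof (induction e)
  case (Loc x)
  show ?case
    by (simp add: compiles_def exec_opr_def)
next
  case (Num a)
  show ?case
    by (simp add: compiles_def exec_opr_def)
next
  case (One m)
  show ?case
    by (simp add: compiles_def exec_opr_def)
next
  case (Plus d e)
  then have de: "shaped D V d" "shaped D V e"
    and dims: "dim_row (val V d) = dim_row (val V e)" "dim_col (val V d) = dim_col (val V e)"
    by auto
  have "compiles V (d [+] e) (val V (d [+] e)) (nops d * (2 * D ^ 3) + nops e * (2 * D ^ 3) + 2 * D ^ 3)"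
  proof (rule compiles_binary[where d = d and e = e and A = "val V d" and B = "val V e" and op = Add])
    show "compiles V d (val V d) (nops d * (2 * D ^ 3))" "compiles V e (val V e) (nops e * (2 * D ^ 3))"
      by (rule Plus.IH(1)[OF de(1)], rule Plus.IH(2)[OF de(2)])
    show "compile v t (d [+] e) = compile (Tmp t) (t + 1) d @ compile (Tmp (t + 1)) (t + 2) e @
        [Assign v (Add (Tmp t) (Tmp (t + 1)))]" for v t
      by simp
    show "\<exists>a \<le> 2 * D ^ 3. exec_opr f J cf cJ (Add x y) s = Some (val V (Plus d e), a)"
      if "s x = Some (val V d)" "s y = Some (val V e)" for x y and s :: store
      using small_cost(1)[OF small_val[OF de(1)] small_val[OF de(1)]]
      by (simp add: exec_opr_def that dims)
  qed simp
  then show ?case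
    by (simp add: algebra_simps)
next
  case (Minus d e)
  then have de: "shaped D V d" "shaped D V e"
    and dims: "dim_row (val V d) = dim_row (val V e)" "dim_col (val V d) = dim_col (val V e)"
    by auto
  have "compiles V (d [-] e) (val V (d [-] e)) (nops d * (2 * D ^ 3) + nops e * (2 * D ^ 3) + 2 * D ^ 3)"
  proof (rule compiles_binary[where d = d and e = e and A = "val V d" and B = "val V e" and op = Sub])
    show "compiles V d (val V d) (nops d * (2 * D ^ 3))" "compiles V e (val V e) (nops e * (2 * D ^ 3))"
      by (rule Minus.IH(1)[OF de(1)], rule Minus.IH(2)[OF de(2)])
    show "compile v t (d [-] e) = compile (Tmp t) (t + 1) d @ compile (Tmp (t + 1)) (t + 2) e @
        [Assign v (Sub (Tmp t) (Tmp (t + 1)))]" for v t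
      by simp
    show "\<exists>a \<le> 2 * D ^ 3. exec_opr f J cf cJ (Sub x y) s = Some (val V (Minus d e), a)"
      if "s x = Some (val V d)" "s y = Some (val V e)" for x y and s :: store
      using small_cost(1)[OF small_val[OF de(1)] small_val[OF de(1)]]
      by (simp add: exec_opr_def that dims)
  qed simp
  then show ?case
    by (simp add: algebra_simps)
next
  case (Times d e)
  then have de: "shaped D V d" "shaped D V e"
    and dims: "dim_col (val V d) = dim_row (val V e)"
    by auto
  have "compiles V (d [*] e) (val V (d [*] e)) (nops d * (2 * D ^ 3) + nops e * (2 * D ^ 3) + 2 * D ^ 3)"
  proof (rule compiles_binary[where d = d and e = e and A = "val V d" and B = "val V e" and op = Mul])
    show "compiles V d (val V d) (nops d * (2 * D ^ 3))" "compiles V e (val V e) (nops e * (2 * D ^ 3))"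
      by (rule Times.IH(1)[OF de(1)], rule Times.IH(2)[OF de(2)])
    show "compile v t (d [*] e) = compile (Tmp t) (t + 1) d @ compile (Tmp (t + 1)) (t + 2) e @
        [Assign v (Mul (Tmp t) (Tmp (t + 1)))]" for v t
      by simp
    show "\<exists>a \<le> 2 * D ^ 3. exec_opr f J cf cJ (Mul x y) s = Some (val V (Times d e), a)"
      if "s x = Some (val V d)" "s y = Some (val V e)" for x y and s :: store
      using small_cost(2)[OF small_val[OF de(1)] small_val[OF de(2)]]
      by (simp add: exec_opr_def that dims)
  qed simp
  then show ?case
    by (simp add: algebra_simps)
next
  case (Smult d e)
  then have de: "shaped D V d" "shaped D V e"
    and dims: "val V d \<in> carrier_mat 1 1"
    by auto
  have "compiles V (d [\<cdot>] e) (val V (d [\<cdot>] e)) (nops d * (2 * D ^ 3) + nops e * (2 * D ^ 3) + 2 * D ^ 3)"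
  proof (rule compiles_binary[where d = d and e = e and A = "val V d" and B = "val V e" and op = Scale])
    show "compiles V d (val V d) (nops d * (2 * D ^ 3))" "compiles V e (val V e) (nops e * (2 * D ^ 3))"
      by (rule Smult.IH(1)[OF de(1)], rule Smult.IH(2)[OF de(2)])
    show "compile v t (d [\<cdot>] e) = compile (Tmp t) (t + 1) d @ compile (Tmp (t + 1)) (t + 2) e @
        [Assign v (Scale (Tmp t) (Tmp (t + 1)))]" for v t
      by simp
    show "\<exists>a \<le> 2 * D ^ 3. exec_opr f J cf cJ (Scale x y) s = Some (val V (Smult d e), a)"
      if "s x = Some (val V d)" "s y = Some (val V e)" for x y and s :: store
      \<comment> \<open>Scaling costs one operation per entry of the second operand, so the size of
        \<open>e\<close> decides.\<close>
      using small_cost(1)[OF small_val[OF de(2)] small_val[OF de(2)]] dims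
      by (simp add: exec_opr_def that)
  qed simp
  then show ?case
    by (simp add: algebra_simps)
next
  case (Transposed e)
  have "compiles V (Transposed e) (val V (Transposed e)) (nops e * (2 * D ^ 3) + 0)"
  proof (rule compiles_unary[where e = e and A = "val V e" and op = Transp])
    show "compiles V e (val V e) (nops e * (2 * D ^ 3))"
      using Transposed by simp
    show "compile v t (Transposed e) = compile (Tmp t) (t + 1) e @ [Assign v (Transp (Tmp t))]" for v t
      by simp
  qed (use Transposed.prems small_val[of D V e] in \<open>simp_all add: exec_opr_def\<close>)
  then show ?case
    by (simp add: algebra_simps)
next
  case (Inverse e)
  have "compiles V (Inverse e) (val V (Inverse e)) (nops e * (2 * D ^ 3) + 2 * D ^ 3)"
  proof (rule compiles_unary[where e = e and A = "val V e" and op = Inv])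
    show "compiles V e (val V e) (nops e * (2 * D ^ 3))"
      using Inverse by simp
    show "compile v t (Inverse e) = compile (Tmp t) (t + 1) e @ [Assign v (Inv (Tmp t))]" for v t
      by simp
    show "\<exists>a \<le> 2 * D ^ 3. exec_opr f J cf cJ (Inv x) s = Some (val V (Inverse e), a)"
      if "s x = Some (val V e)" for x and s :: store
      using small_cost(3)[OF small_val small_val, of D V e V e] Inverse.prems
      by (simp add: exec_opr_def that)
  qed simp
  then show ?case
    by (simp add: algebra_simps)
next
  case (App_f e)
  have "compiles V (App_f e) (val V (App_f e)) (nops e * (2 * D ^ 3) + 2 * D ^ 3)"
  proof (rule compiles_unary[where e = e and A = "val V e" and op = Eval_f])
    show "compiles V e (val V e) (nops e * (2 * D ^ 3))"
      using App_f by simp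
    show "compile v t (App_f e) = compile (Tmp t) (t + 1) e @ [Assign v (Eval_f (Tmp t))]" for v t
      by simp
  qed (use App_f.prems small_val[of D V e] in \<open>simp_all add: exec_opr_def\<close>)
  then show ?case
    by (simp add: algebra_simps)
next
  case (App_J e)
  have "compiles V (App_J e) (val V (App_J e)) (nops e * (2 * D ^ 3) + 2 * D ^ 3)"
  proof (rule compiles_unary[where e = e and A = "val V e" and op = Eval_J])
    show "compiles V e (val V e) (nops e * (2 * D ^ 3))"
      using App_J by simp
    show "compile v t (App_J e) = compile (Tmp t) (t + 1) e @ [Assign v (Eval_J (Tmp t))]" for v t
      by simp
  qed (use App_J.prems small_val[of D V e] in \<open>simp_all add: exec_opr_def\<close>)
  then show ?case
    by (simp add: algebra_simps)
qed

section \<open>Assignment lists checked against a table of final values\<close>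

text \<open>
  A table \<open>V\<close> prescribes the final content of every location. Outside scratch space no
  location is assigned two different values, so it suffices that each assignment produces the
  entry of the table from entries already present.
\<close>

definition computes :: "(loc \<Rightarrow> real mat) \<Rightarrow> loc set \<Rightarrow> instr list \<Rightarrow> loc set \<Rightarrow> nat \<Rightarrow> bool" where
  "computes V X p Y b \<longleftrightarrow> (\<forall>s. (\<forall>x\<in>X. s x = Some (V x)) \<longrightarrow>
     (\<exists>s' a. run f J cf cJ p s = Some (s', a) \<and> (\<forall>x\<in>Y. s' x = Some (V x)) \<and> a \<le> b))"

lemma computes_append:
  assumes "computes V X p Y a" "computes V Y q Z b"
  shows "computes V X (p @ q) Z (a + b)"
  unfolding computes_def
proof (intro allI impI)
  fix s :: store
  assume "\<forall>x\<in>X. s x = Some (V x)"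
  with assms(1) obtain s' a' where 1: "run f J cf cJ p s = Some (s', a')"
    "\<forall>x\<in>Y. s' x = Some (V x)" "a' \<le> a" unfolding computes_def by blast
  with assms(2) obtain s'' b' where 2: "run f J cf cJ q s' = Some (s'', b')"
    "\<forall>x\<in>Z. s'' x = Some (V x)" "b' \<le> b" unfolding computes_def by blast
  show "\<exists>s' c. run f J cf cJ (p @ q) s = Some (s', c) \<and> (\<forall>x\<in>Z. s' x = Some (V x)) \<and> c \<le> a + b"
    by (rule exI[of _ s''], rule exI[of _ "a' + b'"]) (use 1 2 in \<open>auto simp: run_append\<close>)
qed

lemma computes_compile:
  assumes "shaped D V e" "leaves e \<subseteq> X" "X \<inter> scratch t = {}" "val V e = V v"
  shows "computes V X (compile v t e) (insert v X) (nops e * (2 * D ^ 3))"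
  unfolding computes_def
proof (intro allI impI)
  fix s :: store
  assume s: "\<forall>x\<in>X. s x = Some (V x)"
  obtain s' a where s': "run f J cf cJ (compile v t e) s = Some (s', a)"
    "s' v = Some (V v)" "\<And>x. x \<noteq> v \<Longrightarrow> x \<notin> scratch t \<Longrightarrow> s' x = s x" "a \<le> nops e * (2 * D ^ 3)"
    by (rule compilesE[OF compiles_val[OF assms(1)], of t s v]) (use assms s in auto)
  have "s' x = Some (V x)" if "x \<in> insert v X" for x
  proof (cases "x = v")
    case False
    then have "x \<in> X" "x \<notin> scratch t" using that assms(3) by auto
    then show ?thesis using False s s'(3) by simp
  qed (simp add: s'(2))
  with s'(1,4) show "\<exists>s' a. run f J cf cJ (compile v t e) s = Some (s', a) \<and>
      (\<forall>x\<in>insert v X. s' x = Some (V x)) \<and> a \<le> nops e * (2 * D ^ 3)"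
    by blast
qed

text \<open>Reduces an assignment list to static checks against \<open>V\<close>, without any store
  or execution, so that concrete programs are verified by unfolding. \<open>X\<close> stands for the
  locations that already hold their table entries.\<close>

fun correct :: "nat \<Rightarrow> (loc \<Rightarrow> real mat) \<Rightarrow> loc set \<Rightarrow> (loc \<times> expr) list \<Rightarrow> bool" where
  "correct D V X [] \<longleftrightarrow> True"
| "correct D V X ((v, e) # as) \<longleftrightarrow>
     leaves e \<subseteq> X \<and> shaped D V e \<and> val V e = V v \<and> correct D V (insert v X) as"

lemma correct_append:
  "correct D V X (as @ bs) \<longleftrightarrow> correct D V X as \<and> correct D V (X \<union> fst ` set as) bs"
  by (induction D V X as rule: correct.induct) (auto simp: Un_commute)

text \<open>Every expression reads only locations of the initial \<open>X\<close>, so the order in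
  which the neighbours are treated is immaterial.\<close>

lemma correct_map:
  assumes "\<And>j. j \<in> set js \<Longrightarrow> leaves (e j) \<subseteq> X \<and> shaped D V (e j) \<and> val V (e j) = V (v j)"
  shows "correct D V X (map (\<lambda>j. (v j, e j)) js)"
  using assms by (induction js arbitrary: X) (auto, blast)

text \<open>All assignments reuse the same scratch space from \<open>t\<close> on; inputs and
  targets stay clear of it, so that results survive the later assignments.\<close>

lemma computes_compile_all:
  assumes "correct D V X as" "X \<inter> scratch t = {}" "fst ` set as \<inter> scratch t = {}"
  shows "computes V X (compile_all t as) (X \<union> fst ` set as) ((\<Sum>(v, e)\<leftarrow>as. nops e) * (2 * D ^ 3))"
  using assms
proof (induction D V X as rule: correct.induct)
  case (1 D V X)
  then show ?case by (simp add: computes_def compile_all_def)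
next
  case (2 D V X v e as)
  have "computes V X (compile v t e) (insert v X) (nops e * (2 * D ^ 3))"
    using "2.prems" by (intro computes_compile) auto
  moreover have "computes V (insert v X) (compile_all t as) (insert v X \<union> fst ` set as)
      ((\<Sum>(v, e)\<leftarrow>as. nops e) * (2 * D ^ 3))"
    using "2.prems" by (intro "2.IH") auto
  ultimately have "computes V X (compile v t e @ compile_all t as) (insert v X \<union> fst ` set as)
      (nops e * (2 * D ^ 3) + (\<Sum>(v, e)\<leftarrow>as. nops e) * (2 * D ^ 3))"
    by (rule computes_append)
  then show ?case by (simp add: compile_all_def algebra_simps)
qed

lemma val_sum_expr:
  assumes "distinct js" "val V z = 0\<^sub>m m l" "\<And>j. j \<in> set js \<Longrightarrow> val V (g j) \<in> carrier_mat m l"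
  shows "val V (sum_expr z g js) = msum m l (\<lambda>j. val V (g j)) (set js)"
  using assms
  by (induction js) (auto simp: sum_expr_def msum_empty msum_insert)

text \<open>Each addition needs the shape of the partial sum behind it, which is read off from
  \<open>val_sum_expr\<close> applied to the tail of the list.\<close>

lemma shaped_sum_expr:
  assumes "distinct js" "val V z = 0\<^sub>m m l" "shaped D V z"
    "\<And>j. j \<in> set js \<Longrightarrow> val V (g j) \<in> carrier_mat m l \<and> shaped D V (g j)"
  shows "shaped D V (sum_expr z g js)"
  using assms
proof (induction js)
  case (Cons j js)
  then have "val V (foldr (\<lambda>j e. g j [+] e) js z) = msum m l (\<lambda>j. val V (g j)) (set js)"
    using val_sum_expr[of js V z m l g] by (simp add: sum_expr_def)
  with Cons show ?case by (auto simp: sum_expr_def)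
qed (auto simp: sum_expr_def)

end


section \<open>The program of a node\<close>

definition F_plus_G_loc :: loc where "F_plus_G_loc = Tmp 0"
definition R_inv_loc :: loc where "R_inv_loc = Tmp 1"
definition info_loc :: loc where "info_loc = Tmp 2"
definition R_hat_inv_loc :: loc where "R_hat_inv_loc = Tmp 3"
definition gain_loc :: loc where "gain_loc = Tmp 4"
definition info_innov_loc :: loc where "info_innov_loc = Tmp 5"
definition correction_loc :: loc where "correction_loc = Tmp 6"
definition mix_loc :: loc where "mix_loc = Tmp 7"

lemmas loc_defs = F_plus_G_loc_def R_inv_loc_def info_loc_def R_hat_inv_loc_def
  gain_loc_def info_innov_loc_def correction_loc_def mix_loc_def

text \<open>\<open>info_loc\<close> receives W, and \<open>gain_loc\<close> the scalar (a + a^2) (N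
  - 1), so that zeta_j is \<open>gain_loc\<close> times the squared weight of j.
  \<open>R_hat_inv_loc\<close> is kept because the own gain needs it again.\<close>

definition own_steps :: "nat \<Rightarrow> nat \<Rightarrow> nat \<Rightarrow> (loc \<times> expr) list" where
  "own_steps N n i =
    [(F_plus_G_loc, App_J (Loc (In_Est i)) [+] (Loc In_Cstr [*] Loc (In_Wgt i)) [\<cdot>] Loc In_G),
     (Out Breve_Cov, Loc F_plus_G_loc [*] Loc (In_Cov i) [*] Transposed (Loc F_plus_G_loc) [+] Loc In_Q),
     (Out Noise_Cov_Hat, Inverse (Num 1 [+] Loc In_Cstr) [\<cdot>] Loc In_R [-]
        Inverse (Loc In_Lam) [\<cdot>]
          (Loc In_H [*] Loc In_E [*] Transposed (Loc In_E) [*] Transposed (Loc In_H))),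
     (R_hat_inv_loc, Inverse (Loc (Out Noise_Cov_Hat))),
     (Out Own_Cov, Inverse (Inverse (Loc (Out Breve_Cov))
        [+] Transposed (Loc In_H) [*] Loc R_hat_inv_loc [*] Loc In_H
        [+] (Num 2 [*] Loc In_Lam) [\<cdot>] One n)),
     (R_inv_loc, Inverse (Loc In_R)),
     (info_loc, Transposed (Loc In_G) [*] Transposed (Loc In_H) [*] Loc R_inv_loc [*] Loc In_H [*] Loc In_G),
     (gain_loc, (Loc In_Cstr [+] Loc In_Cstr [*] Loc In_Cstr) [*] Num (real N - 1))]"

definition nbr_cov_expr :: "nat \<Rightarrow> expr" where
  "nbr_cov_expr j = Inverse (Inverse (Loc (In_Cov j))
     [+] (Loc (In_Wgt j) [*] Loc (In_Wgt j) [*] Loc gain_loc) [\<cdot>] Loc info_loc)"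

definition nbr_summand :: "nat \<Rightarrow> expr" where
  "nbr_summand j = (Loc (In_Wgt j) [*] Loc (In_Wgt j)) [\<cdot>]
     (Loc In_G [*] Loc (Out (Nbr_Cov j)) [*] Transposed (Loc In_G))"

definition prior_summand :: "nat \<Rightarrow> expr" where
  "prior_summand j = Loc (In_Wgt j) [\<cdot>] (Loc In_G [*] Loc (In_Est j))"

text \<open>All operands have dimensions n or 1, which allows a price in n alone for this block with
  loops over neighbours. The zero column that starts the second sum is the own estimate scaled by 0,
  because \<open>One n\<close> only yields square zeros.\<close>

definition cov_steps :: "nat \<Rightarrow> nat \<Rightarrow> nat list \<Rightarrow> nat list \<Rightarrow> (loc \<times> expr) list" where
  "cov_steps n i js ls =
     map (\<lambda>j. (Out (Nbr_Cov j), nbr_cov_expr j)) js @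
    [(Out Next_Cov, (Num 1 [+] Loc In_Cstr) [\<cdot>] Loc (Out Own_Cov)
        [+] Loc gain_loc [\<cdot>] sum_expr (Num 0 [\<cdot>] One n) nbr_summand js),
     (Out Prior, App_f (Loc (In_Est i))
        [+] Loc In_Cstr [\<cdot>] sum_expr (Num 0 [\<cdot>] Loc (In_Est i)) prior_summand ls)]"

text \<open>The last block in which dimension r occurs. \<open>info_innov_loc\<close> receives u;
  \<open>correction_loc\<close> is formed here and not within the posterior, since its factors have
  a dimension r.\<close>

definition innov_steps :: "nat \<Rightarrow> (loc \<times> expr) list" where
  "innov_steps i =
    [(Out Prior_U, Loc (Out Prior) [-]
        (Loc In_Lam [*] Inverse (Num 1 [-] Loc In_Alp)) [\<cdot>]
          (Loc F_plus_G_loc [*] Loc (In_Cov i) [*] Loc (In_Est i))),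
     (Out Innov, Loc In_Meas [-] Loc In_H [*] Loc (Out Prior)),
     (Out Innov_U, Loc In_Meas [-] Loc In_H [*] Loc (Out Prior_U)),
     (Out Own_Gain, Loc (Out Own_Cov) [*] Transposed (Loc In_H) [*] Loc R_hat_inv_loc),
     (correction_loc, Loc (Out Own_Gain) [*] Loc (Out Innov_U)),
     (info_innov_loc, Transposed (Loc In_G) [*]
        (Transposed (Loc In_H) [*] (Loc R_inv_loc [*] Loc (Out Innov))))]"

text \<open>The scalar is the factor a pi_ij of the gain times zeta_j, the factor contributed by
  \<open>Z_mat j\<close>.\<close>

definition nbr_gain_innov_expr :: "nat \<Rightarrow> expr" where
  "nbr_gain_innov_expr j =
     (Loc In_Cstr [*] Loc (In_Wgt j) [*] (Loc (In_Wgt j) [*] Loc (In_Wgt j) [*] Loc gain_loc)) [\<cdot>]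
       (Loc In_G [*] (Loc (Out (Nbr_Cov j)) [*] Loc info_innov_loc))"

definition post_summand :: "nat \<Rightarrow> expr" where
  "post_summand j = Loc mix_loc [\<cdot>] Loc (Out (Nbr_Gain_Innov j))"

definition post_steps :: "nat \<Rightarrow> nat list \<Rightarrow> (loc \<times> expr) list" where
  "post_steps i js =
     (mix_loc, Loc In_Alp [*] Inverse (sum_expr (Num 0) (\<lambda>j. Loc (In_Wgt j)) js)) #
     map (\<lambda>j. (Out (Nbr_Gain_Innov j), nbr_gain_innov_expr j)) js @
    [(Out Posterior, (Num 1 [-] Loc In_Alp) [\<cdot>] (Loc (Out Prior_U) [+] Loc correction_loc)
        [+] Loc In_Alp [\<cdot>] Loc (Out Prior)
        [+] sum_expr (Num 0 [\<cdot>] Loc (In_Est i)) post_summand js)]"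

text \<open>The locations \<open>Tmp 0\<close> to \<open>Tmp 7\<close> hold shared values, so scratch space starts at 8.\<close>

definition node_program :: "nat \<Rightarrow> nat \<Rightarrow> nat \<Rightarrow> nat set \<Rightarrow> instr list" where
  "node_program N n i Nb =
     (let js = sorted_list_of_set (Nb - {i}); ls = sorted_list_of_set Nb in
      compile_all 8 (own_steps N n i) @ compile_all 8 (cov_steps n i js ls) @
      compile_all 8 (innov_steps i) @ compile_all 8 (post_steps i js))"

text \<open>The list index at \<open>Tmp t\<close> with t at least 8, and \<open>the\<close> at an
  input that is undefined in the initial store, give unspecified matrices. Such entries are never
  consulted: scratch cells and data of non-neighbours do not belong to the known locations.\<close>

definition table :: "network \<Rightarrow> nat \<Rightarrow> nat \<Rightarrow> loc \<Rightarrow> real mat" where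
  "table S k i v = (case v of
       Out q \<Rightarrow> quantity_value S k i q
     | Tmp t \<Rightarrow>
         [F_plus_G S k i,
          inv_mat (Rm S (k + 1) i),
          transpose_mat (Gm S) * transpose_mat (Hm S i) * inv_mat (Rm S (k + 1) i) * Hm S i * Gm S,
          inv_mat (R_hat S k i),
          scalar_mat ((cstr S + (cstr S)\<^sup>2) * (real (nodes S) - 1)),
          transpose_mat (Gm S) * (transpose_mat (Hm S i) * (inv_mat (Rm S (k + 1) i) * innov S k i)),
          K1 S k i * innov_u S k i,
          scalar_mat (alp S k i / (\<Sum>l\<in>nbrs S i - {i}. wgt S i l))] ! t
     | _ \<Rightarrow> the (init_store S k i v))"

section \<open>One fixed node: dimensions and factoring out the neighbour-dependent scalar\<close>

locale node_step =
  fixes S :: network and k i c :: nat and cf cJ :: nat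
  assumes valid: "valid_network S"
    and node: "i \<in> {1..nodes S}"
    and dims_pos: "1 \<le> sdim S" "1 \<le> mdim S"
    and E_cols: "dim_col (Em S k i) \<le> c * sdim S"
    and cf: "cf \<le> c * sdim S ^ 3"
    and cJ: "cJ \<le> c * sdim S ^ 3"
begin

sublocale evaluation "fhat S" "fhat' S" cf cJ .

abbreviation n where "n \<equiv> sdim S"
abbreviation r where "r \<equiv> mdim S"
abbreviation nbs where "nbs \<equiv> sorted_list_of_set (nbrs S i - {i})"
abbreviation all_nbs where "all_nbs \<equiv> sorted_list_of_set (nbrs S i)"
abbreviation V where "V \<equiv> table S k i"

lemma nbrs: "nbrs S i \<subseteq> {1..nodes S}" "i \<in> nbrs S i" "finite (nbrs S i)"
proof -
  show "nbrs S i \<subseteq> {1..nodes S}" "i \<in> nbrs S i"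
    using valid node unfolding valid_network_def Let_def by blast+
  then show "finite (nbrs S i)" using finite_subset by blast
qed

lemma set_nbs [simp]: "set nbs = nbrs S i - {i}" "set all_nbs = nbrs S i"
  using nbrs(3) by auto

lemma node_carriers:
  shows "Gm S \<in> carrier_mat n n" "Hm S i \<in> carrier_mat r n"
    "Qm S k i \<in> carrier_mat n n" "Rm S l i \<in> carrier_mat r r"
    "dim_row (Em S k i) = n" "meas S l i \<in> carrier_mat r 1"
  using valid node unfolding valid_network_def Let_def pos_def_mat_def by blast+

lemma nbr_carriers:
  assumes "j \<in> nbrs S i"
  shows "xhat S k j \<in> carrier_mat n 1" "Pcov S k j \<in> carrier_mat n n"
  using valid nbrs(1) assms unfolding valid_network_def Let_def by blast+

lemma fhat_carriers:
  assumes "x \<in> carrier_mat n 1"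
  shows "fhat S x \<in> carrier_mat n 1" "fhat' S x \<in> carrier_mat n n"
  using valid assms unfolding valid_network_def Let_def is_jacobian_def by blast+

lemma dims [simp]:
  "dim_row (Gm S) = n" "dim_col (Gm S) = n" "dim_row (Hm S i) = r" "dim_col (Hm S i) = n"
  "dim_row (Qm S k i) = n" "dim_col (Qm S k i) = n" "dim_row (Rm S l i) = r" "dim_col (Rm S l i) = r"
  "dim_row (Em S k i) = n" "dim_row (meas S l i) = r" "dim_col (meas S l i) = 1"
  "dim_row (fhat S (xhat S k i)) = n" "dim_col (fhat S (xhat S k i)) = 1"
  "dim_row (fhat' S (xhat S k i)) = n" "dim_col (fhat' S (xhat S k i)) = n"
  using node_carriers fhat_carriers[OF nbr_carriers(1)[OF nbrs(2)]] by auto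

lemma nbr_dims [simp]:
  assumes "j \<in> nbrs S i"
  shows "dim_row (xhat S k j) = n" "dim_col (xhat S k j) = 1"
    "dim_row (Pcov S k j) = n" "dim_col (Pcov S k j) = n"
  using nbr_carriers[OF assms] by auto

lemma own_dims [simp]:
  "dim_row (xhat S k i) = n" "dim_col (xhat S k i) = 1"
  "dim_row (Pcov S k i) = n" "dim_col (Pcov S k i) = n"
  using nbrs(2) by auto

lemma quantity_dims [simp]:
  "dim_row (F_plus_G S k i) = n" "dim_col (F_plus_G S k i) = n"
  "dim_row (P_breve S k i) = n" "dim_col (P_breve S k i) = n"
  "dim_row (R_hat S k i) = r" "dim_col (R_hat S k i) = r"
  "dim_row (Z_mat S k i j) = r" "dim_col (Z_mat S k i j) = r"
  "dim_row (own_cov S k i) = n" "dim_col (own_cov S k i) = n"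
  "dim_row (x_prior S k i) = n" "dim_col (x_prior S k i) = 1"
  "dim_row (x_prior_u S k i) = n" "dim_col (x_prior_u S k i) = 1"
  "dim_row (innov S k i) = r" "dim_col (innov S k i) = 1"
  "dim_row (innov_u S k i) = r" "dim_col (innov_u S k i) = 1"
  "dim_row (K1 S k i) = n" "dim_col (K1 S k i) = r"
  "dim_row (K2 S k i j) = n" "dim_col (K2 S k i j) = r"
  by (simp_all add: F_plus_G_def P_breve_def R_hat_def Z_mat_def own_cov_def x_prior_def
      x_prior_u_def innov_def innov_u_def K1_def K2_def)

lemma nbr_cov_dims [simp]:
  assumes "j \<in> nbrs S i"
  shows "dim_row (nbr_cov S k i j) = n" "dim_col (nbr_cov S k i j) = n"
  using assms by (simp_all add: nbr_cov_def)

lemma nbr_cov_eq: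
  assumes "j \<in> nbrs S i"
  shows "nbr_cov S k i j = inv_mat (inv_mat (Pcov S k j) +
    ((wgt S i j)\<^sup>2 * ((cstr S + (cstr S)\<^sup>2) * (real (nodes S) - 1))) \<cdot>\<^sub>m
     (transpose_mat (Gm S) * transpose_mat (Hm S i) * inv_mat (Rm S (k + 1) i) * Hm S i * Gm S))"
proof -
  define R' where "R' = inv_mat (Rm S (k + 1) i)"
  have R': "R' \<in> carrier_mat r r"
    unfolding R'_def by (intro inv_mat_carrier node_carriers)
  \<comment> \<open>\<open>R'\<close> is handled as an arbitrary r by r matrix. The scalar is moved
    outwards one factor at a time, and each move needs the carrier of the partial product to its
    left.\<close>
  have eq: "A * B * (z \<cdot>\<^sub>m R') * C * D = z \<cdot>\<^sub>m (A * B * R' * C * D)"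
    if "A \<in> carrier_mat n n" "B \<in> carrier_mat n r" "C \<in> carrier_mat r n" "D \<in> carrier_mat n n"
    for A B C D z
  proof -
    have AB: "A * B \<in> carrier_mat n r"
      using that(1,2) by (rule mult_carrier_mat)
    have ABR: "A * B * R' \<in> carrier_mat n r"
      using AB R' by (rule mult_carrier_mat)
    have ABRC: "A * B * R' * C \<in> carrier_mat n n"
      using ABR that(3) by (rule mult_carrier_mat)
    show ?thesis
      by (simp only: mult_smult_distrib[OF AB R'] mult_smult_assoc_mat[OF ABR that(3)]
          mult_smult_assoc_mat[OF ABRC that(4)])
  qed
  show ?thesis
    using node_carriers eq by (simp add: nbr_cov_def Z_mat_def R'_def mult.assoc)
qed

text \<open>The scalars of the gain and of \<open>Z_mat j\<close> are collected in front and the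
  product is reassociated towards the innovation, so that u, the content of
  \<open>info_innov_loc\<close>, appears as a subterm.\<close>

lemma nbr_gain_innov_eq:
  assumes "j \<in> nbrs S i"
  shows "K2 S k i j * innov S k i =
    (cstr S * wgt S i j * ((wgt S i j)\<^sup>2 * ((cstr S + (cstr S)\<^sup>2) * (real (nodes S) - 1)))) \<cdot>\<^sub>m
     (Gm S * (nbr_cov S k i j * (transpose_mat (Gm S) *
        (transpose_mat (Hm S i) * (inv_mat (Rm S (k + 1) i) * innov S k i)))))"
proof -
  define R' where "R' = inv_mat (Rm S (k + 1) i)"
  have R': "R' \<in> carrier_mat r r"
    unfolding R'_def by (intro inv_mat_carrier node_carriers)
  have "x \<cdot>\<^sub>m (G * A * B * C * (z \<cdot>\<^sub>m R')) * y = (x * z) \<cdot>\<^sub>m (G * (A * (B * (C * (R' * y)))))"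
    if "G \<in> carrier_mat n n" "A \<in> carrier_mat n n" "B \<in> carrier_mat n n" "C \<in> carrier_mat n r"
      "y \<in> carrier_mat r 1" for G A B C x y z
    using that R'
    by (simp add: mult_smult_distrib[of _ n r _ r] mult_smult_assoc_mat[of _ n r _ 1]
        assoc_mult_mat[of _ n n _ n _ r] assoc_mult_mat[of _ n n _ n _ n]
        assoc_mult_mat[of _ n n _ r _ r] assoc_mult_mat[of _ n n _ r _ 1]
        assoc_mult_mat[of _ n n _ n _ 1] assoc_mult_mat[of _ n r _ r _ 1] smult_smult_mat mult_ac)
  from this[OF node_carriers(1) _ transpose_carrier_mat[THEN iffD2, OF node_carriers(1)]
      transpose_carrier_mat[THEN iffD2, OF node_carriers(2)], of "nbr_cov S k i j" "innov S k i"]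
  have "K2 S k i j * innov S k i = (cstr S * wgt S i j *
      ((wgt S i j)\<^sup>2 * (cstr S + (cstr S)\<^sup>2) * (real (nodes S) - 1))) \<cdot>\<^sub>m
     (Gm S * (nbr_cov S k i j * (transpose_mat (Gm S) *
        (transpose_mat (Hm S i) * (R' * innov S k i)))))"
    unfolding K2_def Z_mat_def R'_def[symmetric]
    using quantity_dims nbr_cov_dims[OF assms] by (blast intro: carrier_matI)
  then show ?thesis
    unfolding R'_def by (simp only: mult.assoc)
qed

lemma table_simps [simp]:
  "V (Out q) = quantity_value S k i q"
  "V F_plus_G_loc = F_plus_G S k i"
  "V R_inv_loc = inv_mat (Rm S (k + 1) i)"
  "V info_loc =
     transpose_mat (Gm S) * transpose_mat (Hm S i) * inv_mat (Rm S (k + 1) i) * Hm S i * Gm S"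
  "V R_hat_inv_loc = inv_mat (R_hat S k i)"
  "V gain_loc = scalar_mat ((cstr S + (cstr S)\<^sup>2) * (real (nodes S) - 1))"
  "V info_innov_loc =
     transpose_mat (Gm S) * (transpose_mat (Hm S i) * (inv_mat (Rm S (k + 1) i) * innov S k i))"
  "V correction_loc = K1 S k i * innov_u S k i"
  "V mix_loc = scalar_mat (alp S k i / (\<Sum>l\<in>nbrs S i - {i}. wgt S i l))"
  "V In_Meas = meas S (k + 1) i"
  "V In_Cstr = scalar_mat (cstr S)" "V In_G = Gm S" "V In_H = Hm S i" "V In_Q = Qm S k i"
  "V In_R = Rm S (k + 1) i" "V In_E = Em S k i" "V In_Lam = scalar_mat (lam S k i)"
  "V In_Alp = scalar_mat (alp S k i)"
  by (simp_all add: table_def init_store_def loc_defs)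

lemma table_nbr_simps [simp]:
  assumes "j \<in> nbrs S i"
  shows "V (In_Est j) = xhat S k j" "V (In_Cov j) = Pcov S k j" "V (In_Wgt j) = scalar_mat (wgt S i j)"
  using assms by (simp_all add: table_def init_store_def)

lemma table_own_simps [simp]:
  "V (In_Est i) = xhat S k i" "V (In_Cov i) = Pcov S k i" "V (In_Wgt i) = scalar_mat (wgt S i i)"
  using nbrs(2) by simp_all

section \<open>Verification of the four blocks\<close>

definition inputs :: "loc set" where
  "inputs = {In_Meas, In_Cstr, In_G, In_H, In_Q, In_R, In_E, In_Lam, In_Alp} \<union>
     In_Est ` nbrs S i \<union> In_Cov ` nbrs S i \<union> In_Wgt ` nbrs S i"

lemma init_store_inputs: "x \<in> inputs \<Longrightarrow> init_store S k i x = Some (V x)"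
  by (auto simp: inputs_def init_store_def)

definition own_known :: "loc set" where "own_known = inputs \<union> fst ` set (own_steps (nodes S) n i)"
definition cov_known :: "loc set" where "cov_known = own_known \<union> fst ` set (cov_steps n i nbs all_nbs)"
definition innov_known :: "loc set" where "innov_known = cov_known \<union> fst ` set (innov_steps i)"

lemma correct_own_steps:
  assumes "n \<le> D" "r \<le> D" "dim_col (Em S k i) \<le> D" "cJ \<le> 2 * D ^ 3"
  shows "correct D V inputs (own_steps (nodes S) n i)"
  using assms dims_pos nbrs(2)
  by (simp add: own_steps_def small_def inputs_def F_plus_G_def P_breve_def R_hat_def own_cov_def
      power2_eq_square)

lemma nbr_summands:
  assumes "j \<in> nbrs S i" "n \<le> D"
  shows "shaped D V (nbr_summand j)" "shaped D V (prior_summand j)" "shaped D V (post_summand j)"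
    and "val V (nbr_summand j) = (wgt S i j)\<^sup>2 \<cdot>\<^sub>m (Gm S * nbr_cov S k i j * transpose_mat (Gm S))"
    and "val V (prior_summand j) = wgt S i j \<cdot>\<^sub>m (Gm S * xhat S k j)"
    and "val V (post_summand j) =
      (alp S k i / (\<Sum>l\<in>nbrs S i - {i}. wgt S i l)) \<cdot>\<^sub>m (K2 S k i j * innov S k i)"
  using assms dims_pos
  by (simp_all add: nbr_summand_def prior_summand_def post_summand_def small_def power2_eq_square)

lemma sum_nbr_summands:
  assumes "n \<le> D"
  defines "z \<equiv> Num 0 [\<cdot>] One n" and "z' \<equiv> Num 0 [\<cdot>] Loc (In_Est i)"
  shows "shaped D V (sum_expr z nbr_summand nbs)"
    and "shaped D V (sum_expr z' prior_summand all_nbs)"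
    and "shaped D V (sum_expr z' post_summand nbs)"
    and "shaped D V (sum_expr (Num 0) (\<lambda>j. Loc (In_Wgt j)) nbs)"
    and "val V (sum_expr z nbr_summand nbs) = msum n n
      (\<lambda>j. (wgt S i j)\<^sup>2 \<cdot>\<^sub>m (Gm S * nbr_cov S k i j * transpose_mat (Gm S))) (nbrs S i - {i})"
    and "val V (sum_expr z' prior_summand all_nbs) =
      msum n 1 (\<lambda>j. wgt S i j \<cdot>\<^sub>m (Gm S * xhat S k j)) (nbrs S i)"
    and "val V (sum_expr z' post_summand nbs) = msum n 1
      (\<lambda>j. (alp S k i / (\<Sum>l\<in>nbrs S i - {i}. wgt S i l)) \<cdot>\<^sub>m (K2 S k i j * innov S k i))
      (nbrs S i - {i})"
    and "val V (sum_expr (Num 0) (\<lambda>j. Loc (In_Wgt j)) nbs) =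
      scalar_mat (\<Sum>j\<in>nbrs S i - {i}. wgt S i j)"
proof -
  note summands = nbr_summands[OF _ assms(1)]
  have z: "val V z = 0\<^sub>m n n" "shaped D V z" "val V z' = 0\<^sub>m n 1" "shaped D V z'"
    "val V (Num 0) = 0\<^sub>m 1 1" "shaped D V (Num 0)"
    using assms(1) dims_pos by (simp_all add: z_def z'_def small_def, simp add: scalar_mat_def zero_mat_def)
  have c1: "val V (nbr_summand j) \<in> carrier_mat n n \<and> shaped D V (nbr_summand j)"
    and c2: "val V (prior_summand j) \<in> carrier_mat n 1 \<and> shaped D V (prior_summand j)"
    and c3: "val V (post_summand j) \<in> carrier_mat n 1 \<and> shaped D V (post_summand j)"
    and c4: "val V (Loc (In_Wgt j)) \<in> carrier_mat 1 1 \<and> shaped D V (Loc (In_Wgt j))"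
    if "j \<in> nbrs S i" for j
    using that assms(1) dims_pos
    by (auto intro!: carrier_matI simp: summands small_def)
  show "shaped D V (sum_expr z nbr_summand nbs)"
    by (rule shaped_sum_expr[OF _ z(1,2)]) (use c1 in auto)
  show "shaped D V (sum_expr z' prior_summand all_nbs)"
    by (rule shaped_sum_expr[OF _ z(3,4)]) (use c2 in auto)
  show "shaped D V (sum_expr z' post_summand nbs)"
    by (rule shaped_sum_expr[OF _ z(3,4)]) (use c3 in auto)
  show "shaped D V (sum_expr (Num 0) (\<lambda>j. Loc (In_Wgt j)) nbs)"
    by (rule shaped_sum_expr[OF _ z(5,6)]) (use c4 in auto)
  have "val V (sum_expr z nbr_summand nbs) = msum n n (\<lambda>j. val V (nbr_summand j)) (set nbs)"
    by (rule val_sum_expr[OF _ z(1)]) (use c1 in auto)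
  also have "\<dots> = msum n n
      (\<lambda>j. (wgt S i j)\<^sup>2 \<cdot>\<^sub>m (Gm S * nbr_cov S k i j * transpose_mat (Gm S))) (nbrs S i - {i})"
    unfolding set_nbs by (rule msum_cong) (simp add: summands)
  finally show "val V (sum_expr z nbr_summand nbs) = msum n n
      (\<lambda>j. (wgt S i j)\<^sup>2 \<cdot>\<^sub>m (Gm S * nbr_cov S k i j * transpose_mat (Gm S))) (nbrs S i - {i})" .
  have "val V (sum_expr z' prior_summand all_nbs) = msum n 1 (\<lambda>j. val V (prior_summand j)) (set all_nbs)"
    by (rule val_sum_expr[OF _ z(3)]) (use c2 in auto)
  also have "\<dots> = msum n 1 (\<lambda>j. wgt S i j \<cdot>\<^sub>m (Gm S * xhat S k j)) (nbrs S i)"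
    unfolding set_nbs by (rule msum_cong) (simp add: summands)
  finally show "val V (sum_expr z' prior_summand all_nbs) =
      msum n 1 (\<lambda>j. wgt S i j \<cdot>\<^sub>m (Gm S * xhat S k j)) (nbrs S i)" .
  have "val V (sum_expr z' post_summand nbs) = msum n 1 (\<lambda>j. val V (post_summand j)) (set nbs)"
    by (rule val_sum_expr[OF _ z(3)]) (use c3 in auto)
  also have "\<dots> = msum n 1
      (\<lambda>j. (alp S k i / (\<Sum>l\<in>nbrs S i - {i}. wgt S i l)) \<cdot>\<^sub>m (K2 S k i j * innov S k i))
      (nbrs S i - {i})"
    unfolding set_nbs by (rule msum_cong) (simp add: summands)
  finally show "val V (sum_expr z' post_summand nbs) = msum n 1
      (\<lambda>j. (alp S k i / (\<Sum>l\<in>nbrs S i - {i}. wgt S i l)) \<cdot>\<^sub>m (K2 S k i j * innov S k i))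
      (nbrs S i - {i})" .
  have "val V (sum_expr (Num 0) (\<lambda>j. Loc (In_Wgt j)) nbs) = msum 1 1 (\<lambda>j. val V (Loc (In_Wgt j))) (set nbs)"
    by (rule val_sum_expr[OF _ z(5)]) (use c4 in auto)
  also have "\<dots> = msum 1 1 (\<lambda>j. scalar_mat (wgt S i j)) (nbrs S i - {i})"
    unfolding set_nbs by (rule msum_cong) simp
  finally show "val V (sum_expr (Num 0) (\<lambda>j. Loc (In_Wgt j)) nbs) =
      scalar_mat (\<Sum>j\<in>nbrs S i - {i}. wgt S i j)"
    unfolding msum_scalar_mat .
qed

text \<open>\<open>D\<close> is bounded below by n but not by r: this certifies that the work per
  neighbour involves no matrix with dimension r. \<open>nbr_cov_eq\<close> reconciles the shared W
  with the defined covariances.\<close>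

lemma correct_cov_steps:
  assumes "n \<le> D" "cf \<le> 2 * D ^ 3"
  shows "correct D V own_known (cov_steps n i nbs all_nbs)"
  unfolding cov_steps_def correct_append
proof
  show "correct D V own_known (map (\<lambda>j. (Out (Nbr_Cov j), nbr_cov_expr j)) nbs)"
    by (rule correct_map)
      (use assms dims_pos in \<open>auto simp: nbr_cov_expr_def own_known_def own_steps_def inputs_def small_def
        nbr_cov_eq power2_eq_square\<close>)
qed (use assms dims_pos nbrs(2) in \<open>auto simp: sum_nbr_summands own_known_def own_steps_def inputs_def small_def
  P_next_def x_prior_def nbr_summand_def prior_summand_def image_image\<close>)

lemma correct_innov_steps:
  assumes "n \<le> D" "r \<le> D"
  shows "correct D V cov_known (innov_steps i)"
  using assms dims_pos nbrs(2)
  by (simp add: innov_steps_def cov_known_def own_known_def own_steps_def cov_steps_def inputs_def small_def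
      x_prior_u_def innov_def innov_u_def K1_def divide_inverse)

text \<open>Again \<open>D\<close> is bounded below only by n. \<open>nbr_gain_innov_eq\<close>
  matches the products with u, and \<open>divide_inverse\<close> covers the mixing weight even if
  the weights sum to 0.\<close>

lemma correct_post_steps:
  assumes "n \<le> D"
  shows "correct D V innov_known (post_steps i nbs)"
  unfolding post_steps_def correct.simps(2) correct_append
proof (intro conjI)
  show "correct D V (insert mix_loc innov_known) (map (\<lambda>j. (Out (Nbr_Gain_Innov j), nbr_gain_innov_expr j)) nbs)"
    by (rule correct_map)
      (use assms dims_pos in \<open>auto simp: nbr_gain_innov_expr_def innov_known_def cov_known_def own_known_def own_steps_def
        cov_steps_def innov_steps_def inputs_def small_def nbr_gain_innov_eq power2_eq_square
        image_image\<close>)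
qed (use assms dims_pos nbrs(2) in \<open>auto simp: sum_nbr_summands innov_known_def cov_known_def own_known_def own_steps_def
  cov_steps_def innov_steps_def inputs_def small_def x_post_def post_summand_def image_image
  divide_inverse\<close>)

section \<open>Operation count and assembly\<close>

lemma nops_steps:
  "(\<Sum>(v, e)\<leftarrow>own_steps N n i. nops e) = 33"
  "(\<Sum>(v, e)\<leftarrow>cov_steps n i js ls. nops e) = 11 * length js + 3 * length ls + 9"
  "(\<Sum>(v, e)\<leftarrow>innov_steps i. nops e) = 17"
  "(\<Sum>(v, e)\<leftarrow>post_steps i js. nops e) = 10 * length js + 9"
  by (simp_all add: own_steps_def cov_steps_def innov_steps_def post_steps_def nbr_cov_expr_def
      nbr_gain_innov_expr_def nbr_summand_def prior_summand_def post_summand_def o_def sum_list_triv)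

lemma no_scratch:
  "inputs \<inter> scratch 8 = {}"
  "fst ` set (own_steps N n i) \<inter> scratch 8 = {}"
  "fst ` set (cov_steps n i js ls) \<inter> scratch 8 = {}"
  "fst ` set (innov_steps i) \<inter> scratch 8 = {}"
  "fst ` set (post_steps i js) \<inter> scratch 8 = {}"
  by (auto simp: inputs_def scratch_def own_steps_def cov_steps_def innov_steps_def post_steps_def loc_defs)

lemma outputs_computed:
  "Out ` step_quantities i (nbrs S i) \<subseteq> innov_known \<union> fst ` set (post_steps i nbs)"
  by (auto simp: step_quantities_def innov_known_def cov_known_def own_known_def own_steps_def cov_steps_def innov_steps_def
      post_steps_def image_image)

text \<open>184 = 100 + 84. The two fixed blocks have 33 + 17 = 50 charged nodes at the larger
  price. The two looping blocks have at most 11 + 3 + 10 per neighbour and 9 + 9 besides, together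
  at most 42 times the number of neighbours, at the smaller price. Both prices carry a factor
  2.\<close>

lemma node_program_correct:
  "\<exists>s cost. run (fhat S) (fhat' S) cf cJ (node_program (nodes S) n i (nbrs S i)) (init_store S k i) =
      Some (s, cost) \<and>
    (\<forall>q\<in>step_quantities i (nbrs S i). s (Out q) = Some (quantity_value S k i q)) \<and>
    cost \<le> 184 * (c + 1) ^ 3 * (card (nbrs S i) * n ^ 3 + r ^ 3)"
proof -
  \<comment> \<open>With c + 1 in place of c, the sizes dominate n and r also when c = 0.\<close>
  let ?D = "(c + 1) * max n r" and ?D' = "(c + 1) * n"
  have D: "n \<le> ?D" "r \<le> ?D" "dim_col (Em S k i) \<le> ?D" "cJ \<le> 2 * ?D ^ 3"
    and D': "n \<le> ?D'" "cf \<le> 2 * ?D' ^ 3"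
  proof -
    have c_le: "c * x ^ 3 \<le> 2 * ((c + 1) * x) ^ 3" for x
    proof -
      have "c \<le> (c + 1) ^ 3"
        using self_le_power[of "c + 1" 3] by simp
      then have "c * x ^ 3 \<le> (c + 1) ^ 3 * x ^ 3"
        by (rule mult_le_mono1)
      then show ?thesis
        unfolding power_mult_distrib by linarith
    qed
    show "n \<le> ?D" "r \<le> ?D" "n \<le> ?D'"
      by simp_all
    have "c * n \<le> ?D"
      by (intro mult_le_mono) auto
    then show "dim_col (Em S k i) \<le> ?D"
      using E_cols by linarith
    have "c * n ^ 3 \<le> c * max n r ^ 3"
      by (intro mult_le_mono2 power_mono) auto
    then show "cJ \<le> 2 * ?D ^ 3"
      using cJ c_le[of "max n r"] by linarith
    show "cf \<le> 2 * ?D' ^ 3"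
      using cf c_le[of n] by linarith
  qed
  note block = computes_compile_all[where t = 8 and V = V]
  note no_scratch' = no_scratch own_known_def cov_known_def innov_known_def Int_Un_distrib2
  have "computes V inputs (compile_all 8 (own_steps (nodes S) n i)) own_known (33 * (2 * ?D ^ 3))"
    using block[OF correct_own_steps[OF D]] by (simp only: no_scratch' nops_steps Un_empty simp_thms)
  moreover have "computes V own_known (compile_all 8 (cov_steps n i nbs all_nbs)) cov_known
      ((11 * length nbs + 3 * length all_nbs + 9) * (2 * ?D' ^ 3))"
    using block[OF correct_cov_steps[OF D']] by (simp only: no_scratch' nops_steps Un_empty simp_thms)
  moreover have "computes V cov_known (compile_all 8 (innov_steps i)) innov_known (17 * (2 * ?D ^ 3))"
    using block[OF correct_innov_steps[OF D(1,2)]] by (simp only: no_scratch' nops_steps Un_empty simp_thms)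
  moreover have "computes V innov_known (compile_all 8 (post_steps i nbs)) (innov_known \<union> fst ` set (post_steps i nbs))
      ((10 * length nbs + 9) * (2 * ?D' ^ 3))"
    using block[OF correct_post_steps[OF D'(1)]] by (simp only: no_scratch' nops_steps Un_empty simp_thms)
  ultimately have "computes V inputs (node_program (nodes S) n i (nbrs S i))
     (innov_known \<union> fst ` set (post_steps i nbs))
     (33 * (2 * ?D ^ 3) + ((11 * length nbs + 3 * length all_nbs + 9) * (2 * ?D' ^ 3) +
       (17 * (2 * ?D ^ 3) + (10 * length nbs + 9) * (2 * ?D' ^ 3))))"
    unfolding node_program_def Let_def by (intro computes_append)
  then obtain s cost where run:
    "run (fhat S) (fhat' S) cf cJ (node_program (nodes S) n i (nbrs S i)) (init_store S k i) = Some (s, cost)"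
    and s: "\<forall>x \<in> innov_known \<union> fst ` set (post_steps i nbs). s x = Some (V x)"
    and cost: "cost \<le> 33 * (2 * ?D ^ 3) + ((11 * length nbs + 3 * length all_nbs + 9) * (2 * ?D' ^ 3) +
       (17 * (2 * ?D ^ 3) + (10 * length nbs + 9) * (2 * ?D' ^ 3)))"
    unfolding computes_def using init_store_inputs by blast
  have "s (Out q) = Some (quantity_value S k i q)" if "q \<in> step_quantities i (nbrs S i)" for q
    using s outputs_computed that by (metis (no_types) image_subset_iff table_simps(1))
  moreover have "cost \<le> 184 * (c + 1) ^ 3 * (card (nbrs S i) * n ^ 3 + r ^ 3)"
  proof -
    let ?m = "card (nbrs S i)"
    have len: "length nbs \<le> ?m" "length all_nbs = ?m"
      using nbrs(3) by (auto simp: card_Diff_singleton_if)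
    \<comment> \<open>Node i belongs to its own neighbour set, so a fixed number of operations of
      order n^3 is absorbed by the first summand of the bound.\<close>
    have m: "1 \<le> ?m"
      using nbrs(2,3) by (metis One_nat_def Suc_leI card_gt_0_iff empty_iff)
    have "max n r ^ 3 \<le> ?m * n ^ 3 + r ^ 3"
      using m by (cases "n \<le> r") (auto simp: max_def intro: trans_le_add1 trans_le_add2)
    then have big: "?D ^ 3 \<le> (c + 1) ^ 3 * (?m * n ^ 3 + r ^ 3)"
      unfolding power_mult_distrib by (rule mult_le_mono2)
    have small: "?m * ?D' ^ 3 \<le> (c + 1) ^ 3 * (?m * n ^ 3 + r ^ 3)"
    proof -
      have "?m * ?D' ^ 3 = (c + 1) ^ 3 * (?m * n ^ 3)"
        by (simp only: power_mult_distrib mult.left_commute)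
      also have "\<dots> \<le> (c + 1) ^ 3 * (?m * n ^ 3 + r ^ 3)"
        by (rule mult_le_mono2) simp
      finally show ?thesis .
    qed
    have "11 * length nbs + 3 * length all_nbs + 9 + (10 * length nbs + 9) \<le> 42 * ?m"
      using len m by linarith
    then have "(11 * length nbs + 3 * length all_nbs + 9 + (10 * length nbs + 9)) * (2 * ?D' ^ 3)
        \<le> 42 * ?m * (2 * ?D' ^ 3)"
      by (rule mult_le_mono1)
    then have "(11 * length nbs + 3 * length all_nbs + 9) * (2 * ?D' ^ 3) +
        (10 * length nbs + 9) * (2 * ?D' ^ 3) \<le> 84 * (?m * ?D' ^ 3)"
      unfolding add_mult_distrib by linarith
    with cost have "cost \<le> 100 * ?D ^ 3 + 84 * (?m * ?D' ^ 3)"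
      by linarith
    also have "\<dots> \<le> 184 * ((c + 1) ^ 3 * (?m * n ^ 3 + r ^ 3))"
      using big small by linarith
    finally show ?thesis by (simp only: mult.assoc)
  qed
  ultimately show ?thesis using run by blast
qed

end

text \<open>The constant depends on c alone. The witness \<open>node_program\<close> is built from
  N, n, i and Nb, before the network data, the step and the evaluation costs are given, so one
  program serves all of them and nothing can be precomputed from the data.\<close>

theorem proposition1:
  fixes c :: nat
  shows "\<exists>C::nat. \<forall>N n r i Nb. n \<ge> 1 \<and> r \<ge> 1 \<and> i \<in> {1..N} \<longrightarrow>
    (\<exists>prog. \<forall>S k cf cJ.
       valid_network S \<and> nodes S = N \<and> sdim S = n \<and> mdim S = r \<and> nbrs S i = Nb \<and>
       dim_col (Em S k i) \<le> c * n \<and> cf \<le> c * n ^ 3 \<and> cJ \<le> c * n ^ 3 \<longrightarrow>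
       (\<exists>s cost.
          run (fhat S) (fhat' S) cf cJ prog (init_store S k i) = Some (s, cost) \<and>
          (\<forall>q \<in> step_quantities i Nb. s (Out q) = Some (quantity_value S k i q)) \<and>
          cost \<le> C * (card Nb * n ^ 3 + r ^ 3)))"
proof (intro exI[of _ "184 * (c + 1) ^ 3"] allI impI, elim conjE)
  fix N n r i :: nat and Nb :: "nat set"
  assume nr: "1 \<le> n" "1 \<le> r" "i \<in> {1..N}"
  show "\<exists>prog. \<forall>S k cf cJ.
       valid_network S \<and> nodes S = N \<and> sdim S = n \<and> mdim S = r \<and> nbrs S i = Nb \<and>
       dim_col (Em S k i) \<le> c * n \<and> cf \<le> c * n ^ 3 \<and> cJ \<le> c * n ^ 3 \<longrightarrow>
       (\<exists>s cost.
          run (fhat S) (fhat' S) cf cJ prog (init_store S k i) = Some (s, cost) \<and>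
          (\<forall>q \<in> step_quantities i Nb. s (Out q) = Some (quantity_value S k i q)) \<and>
          cost \<le> 184 * (c + 1) ^ 3 * (card Nb * n ^ 3 + r ^ 3))"
  proof (intro exI[of _ "node_program N n i Nb"] allI impI, elim conjE)
    fix S k cf cJ
    assume *: "valid_network S" "nodes S = N" "sdim S = n" "mdim S = r" "nbrs S i = Nb"
      "dim_col (Em S k i) \<le> c * n" "cf \<le> c * n ^ 3" "cJ \<le> c * n ^ 3"
    interpret node_step S k i c cf cJ
      using * nr by unfold_locales simp_all
    show "\<exists>s cost.
          run (fhat S) (fhat' S) cf cJ (node_program N n i Nb) (init_store S k i) = Some (s, cost) \<and>
          (\<forall>q \<in> step_quantities i Nb. s (Out q) = Some (quantity_value S k i q)) \<and>
          cost \<le> 184 * (c + 1) ^ 3 * (card Nb * n ^ 3 + r ^ 3)"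
      using node_program_correct unfolding *(2-5) .
  qed
qed

end
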